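(* Let $n\in\mathbb N$ and let $T:\mathbb C_n[z]\to\mathbb C[z]$ be a linear operator. Then $T$ maps $\pi_n(\mathbb R)$ into $\pi(\mathbb R)\cup\{0\}$ if and only if one of the following holds: (a) $T$ has range of dimension at most one and $T(f)=\alpha(f)P$ for $f\in\mathbb C_n[z]$, where $\alpha:\mathbb C_n[z]\to\mathbb C$ is a linear functional and $P\in\mathcal H_1(\mathbb R)$; (b) $T$ has range of dimension at most two and $T(f)=\eta\alpha(f)P+\eta\beta(f)Q$ for $f\in\mathbb C_n[z]$, where $\eta\in\mathbb C$, $\alpha,\beta:\mathbb C_n[z]\to\mathbb C$ are linear functionals with $\alpha(\mathbb R_n[z])\subseteq\mathbb R$, $\beta(\mathbb R_n[z])\subseteq\mathbb R$, and $P,Q\in\mathcal H_1(\mathbb R)$ have interlacing zeros; (c) there is $\eta\in\mathbb C$ with $\eta\,T[(z+w)^n]\in\mathcal H_2(\mathbb R)$; (d) there is $\eta\in\mathbb C$ with $\eta\,T[(z-w)^n]\in\mathcal H_2(\mathbb R)$.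
   Context: For $\Omega\subseteq\mathbb C$, $\pi(\Omega)$ is the set of non-zero univariate complex polynomials all of whose zeros lie in $\Omega$ (non-zero constants included) and $\pi_n(\Omega)$ is the subset of those of degree at most $n$. $\mathbb C_n[z]$ ($\mathbb R_n[z]$) denotes complex (real) polynomials of degree at most $n$. A polynomial $f\in\mathbb C[z_1,\dots,z_k]$ is stable if it is non-zero and $f(z_1,\dots,z_k)\neq0$ whenever $\Im z_j>0$ for all $j$; real stable if moreover its coefficients are real. $\mathcal H_k(\mathbb C)$, $\mathcal H_k(\mathbb R)$ denote the stable, resp. real stable, polynomials in $k$ variables; so $\mathcal H_1(\mathbb R)$ is the set of non-zero real polynomials with only real zeros. The zeros $\alpha_1\le\dots\le\alpha_p$ and $\beta_1\le\dots\le\beta_q$ of two such polynomials interlace if either $\alpha_1\le\beta_1\le\alpha_2\le\beta_2\le\cdots$ or $\beta_1\le\alpha_1\le\beta_2\le\alpha_2\le\cdots$; the zeros of any two polynomials of degree $0$ or $1$ interlace by convention. $T$ is extended to polynomials in $z,w$ by $T(z^kw^\ell)=T(z^k)w^\ell$. *)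

theory Defs
  imports Complex_Main "HOL-Computational_Algebra.Polynomial" "HOL-Library.Multiset"
begin

definition Cn :: "nat \<Rightarrow> complex poly set" where
  "Cn n = {p. degree p \<le> n}"

definition real_poly :: "complex poly \<Rightarrow> bool" where
  "real_poly p \<longleftrightarrow> (\<forall>i. coeff p i \<in> \<real>)"

definition pi_set :: "complex set \<Rightarrow> complex poly set" where
  "pi_set \<Omega> = {p. p \<noteq> 0 \<and> (\<forall>z. poly p z = 0 \<longrightarrow> z \<in> \<Omega>)}"

definition pi_n_set :: "nat \<Rightarrow> complex set \<Rightarrow> complex poly set" where
  "pi_n_set n \<Omega> = {p \<in> pi_set \<Omega>. degree p \<le> n}"

definition H1R :: "complex poly set" where
  "H1R = {p. real_poly p \<and> p \<in> pi_set \<real>}"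

definition lin_op_on :: "nat \<Rightarrow> (complex poly \<Rightarrow> complex poly) \<Rightarrow> bool" where
  "lin_op_on n T \<longleftrightarrow>
     (\<forall>f\<in>Cn n. \<forall>g\<in>Cn n. T (f + g) = T f + T g) \<and>
     (\<forall>c. \<forall>f\<in>Cn n. T (smult c f) = smult c (T f))"

definition lin_fun_on :: "nat \<Rightarrow> (complex poly \<Rightarrow> complex) \<Rightarrow> bool" where
  "lin_fun_on n \<alpha> \<longleftrightarrow>
     (\<forall>f\<in>Cn n. \<forall>g\<in>Cn n. \<alpha> (f + g) = \<alpha> f + \<alpha> g) \<and>
     (\<forall>c. \<forall>f\<in>Cn n. \<alpha> (smult c f) = c * \<alpha> f)"

definition range_dim_le :: "nat \<Rightarrow> nat \<Rightarrow> (complex poly \<Rightarrow> complex poly) \<Rightarrow> bool" where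
  "range_dim_le k n T \<longleftrightarrow>
     (\<exists>ps :: complex poly list. length ps \<le> k \<and>
        (\<forall>f\<in>Cn n. \<exists>cs :: complex list. length cs = length ps \<and>
            T f = (\<Sum>i<length ps. smult (cs ! i) (ps ! i))))"

definition real_zeros :: "complex poly \<Rightarrow> real list" where
  "real_zeros p = (THE xs. sorted xs \<and>
      (\<forall>r. count (mset xs) r = order (complex_of_real r) p))"

definition chain_interlace :: "real list \<Rightarrow> real list \<Rightarrow> bool" where
  "chain_interlace a b \<longleftrightarrow>
     (length b = length a \<or> length a = length b + 1) \<and>
     (\<forall>i. i < length a \<and> i < length b \<longrightarrow> a ! i \<le> b ! i) \<and>
     (\<forall>i. Suc i < length a \<and> i < length b \<longrightarrow> b ! i \<le> a ! Suc i)"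

definition zeros_interlace :: "complex poly \<Rightarrow> complex poly \<Rightarrow> bool" where
  "zeros_interlace p q \<longleftrightarrow>
     (degree p \<le> 1 \<and> degree q \<le> 1) \<or>
     chain_interlace (real_zeros p) (real_zeros q) \<or>
     chain_interlace (real_zeros q) (real_zeros p)"

(* Bivariate polynomials in z,w are represented as polynomials in w whose
   coefficients are polynomials in z: type complex poly poly. *)

definition eval2 :: "complex poly poly \<Rightarrow> complex \<Rightarrow> complex \<Rightarrow> complex" where
  "eval2 F z w = poly (map_poly (\<lambda>c. poly c z) F) w"

definition H2R :: "complex poly poly set" where
  "H2R = {F. F \<noteq> 0 \<and> (\<forall>l k. coeff (coeff F l) k \<in> \<real>) \<and>
             (\<forall>z w. Im z > 0 \<longrightarrow> Im w > 0 \<longrightarrow> eval2 F z w \<noteq> 0)}"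

definition extT :: "(complex poly \<Rightarrow> complex poly) \<Rightarrow> complex poly poly \<Rightarrow> complex poly poly" where
  "extT T F = (\<Sum>l\<le>degree F. monom (T (coeff F l)) l)"

definition z_plus_w :: "complex poly poly" where
  "z_plus_w = [: [:0, 1:], 1 :]"

definition z_minus_w :: "complex poly poly" where
  "z_minus_w = [: [:0, 1:], -1 :]"

end

theory Submission
  imports Defs "HOL-Analysis.Analysis" "HOL-Computational_Algebra.Fundamental_Theorem_Algebra"
begin

text \<open>Sufficiency of (c): for \<open>z\<close> in the upper half plane, \<open>f \<mapsto> T f (z)\<close> is a linear functional
  whose value on \<open>(\<cdot> + w) ^ n\<close> does not vanish for \<open>w\<close> in the upper half plane; by Grace's theorem it does
  not vanish on products of \<open>n\<close> linear factors with zeros in the open lower half plane, and real-rooted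
  polynomials are limits of such products. Substituting \<open>-z\<close> gives (d). For (b), the argument of \<open>Q / P\<close> on
  the upper half plane is a sum of angles which interlacing confines between consecutive multiples of
  \<open>\<pi>\<close>; conversely, its boundary values count zeros, which recovers interlacing.

  Necessity: the real polynomials \<open>c (z + w) ^ n + cnj c (z + cnj w) ^ n\<close> stay real-rooted under small real
  perturbations. This forces \<open>T\<close> to be real up to a constant or of rank one, and if \<open>T\<close> kills one of them then
  all of \<open>T\<close>'s real values are real-rooted, which bounds the rank by two. Otherwise
  \<open>\<bar>T (\<cdot> + w) ^ n\<bar>\<close> and \<open>\<bar>T (\<cdot> + cnj w) ^ n\<bar>\<close> never agree on the product of upper half
  planes, so by connectedness one of them dominates and hence never vanishes.\<close>

section \<open>Grace's theorem for a half plane\<close>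

text \<open>The moduli enter because c u + cnj c v = 0 has a solution c \<noteq> 0 as soon as u and
  v have equal modulus. Equality at (z, w) therefore yields a real-rooted member of the pencil whose
  image vanishes at the non-real point z, and the hypothesis leaves such an image no choice but to
  be 0. This is where the kernel case comes from.

  Two degenerations shape the statements. Degrees can drop: a polynomial of degree d < n has n - d
  zeros at infinity, and a member of the pencil or its perturbation may lose its leading term. Hence
  counts are made against n instead of the degree, and real-rootedness is read off from sign changes
  at n points without any condition on leading coefficients. Limits can collapse: a limit of
  polynomials without zeros in an open set is zero-free there or identically 0. This accounts for
  \<open>{0}\<close> in the theorem, and it is why the preservation lemmas deduce
  \<open>T f = 0\<close> from a single non-real zero of \<open>T f\<close>.\<close>

lemma lin_op_on_add: "lin_op_on n T \<Longrightarrow> degree f \<le> n \<Longrightarrow> degree g \<le> n \<Longrightarrow> T (f + g) = T f + T g"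
  by (simp add: lin_op_on_def Cn_def)

lemma lin_op_on_smult: "lin_op_on n T \<Longrightarrow> degree f \<le> n \<Longrightarrow> T (smult c f) = smult c (T f)"
  by (simp add: lin_op_on_def Cn_def)

lemma lin_op_on_0: "lin_op_on n T \<Longrightarrow> T 0 = 0"
  using lin_op_on_smult[of n T 0 0] by simp

lemma lin_op_on_sum:
  assumes "lin_op_on n T" "finite A" "\<And>i. i \<in> A \<Longrightarrow> degree (p i) \<le> n"
  shows "T (\<Sum>i\<in>A. smult (c i) (p i)) = (\<Sum>i\<in>A. smult (c i) (T (p i)))"
  using assms(2,3)
proof (induction A rule: finite_induct)
  case empty
  then show ?case using lin_op_on_0[OF assms(1)] by simp
next
  case (insert x F)
  have "degree (\<Sum>i\<in>F. smult (c i) (p i)) \<le> n"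
    using insert by (intro degree_sum_le) (auto intro: order_trans[OF degree_smult_le])
  moreover have "degree (smult (c x) (p x)) \<le> n"
    using insert by (auto intro: order_trans[OF degree_smult_le])
  ultimately show ?case
    using insert by (simp add: lin_op_on_add[OF assms(1)] lin_op_on_smult[OF assms(1)])
qed

lemma lin_op_on_monoms:
  assumes "lin_op_on n T" "degree f \<le> n"
  shows "T f = (\<Sum>j\<le>n. smult (coeff f j) (T (monom 1 j)))"
proof -
  have "f = (\<Sum>j\<le>n. smult (coeff f j) (monom 1 j))"
    using poly_as_sum_of_monoms'[OF assms(2)] by (simp add: smult_monom)
  then have "T f = T (\<Sum>j\<le>n. smult (coeff f j) (monom 1 j))"
    by simp
  also have "\<dots> = (\<Sum>j\<le>n. smult (coeff f j) (T (monom 1 j)))"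
    by (rule lin_op_on_sum[OF assms(1)]) (auto simp: degree_monom_eq)
  finally show ?thesis .
qed

lemma lin_fun_on_sum:
  assumes "lin_fun_on n L" "finite A" "\<And>i. i \<in> A \<Longrightarrow> degree (p i) \<le> n"
  shows "L (\<Sum>i\<in>A. smult (c i) (p i)) = (\<Sum>i\<in>A. c i * L (p i))"
proof -
  have "lin_op_on n (\<lambda>f. [:L f:])"
    using assms(1) by (simp add: lin_op_on_def lin_fun_on_def)
  note lin_op_on_sum[OF this assms(2), where c = c and p = p]
  then have "[:L (\<Sum>i\<in>A. smult (c i) (p i)):] = (\<Sum>i\<in>A. smult (c i) [:L (p i):])"
    using assms(3) by blast
  also have "\<dots> = [:\<Sum>i\<in>A. c i * L (p i):]"
    by (simp add: sum_to_poly)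
  finally show ?thesis by simp
qed

lemma lin_fun_on_poly: "lin_op_on n T \<Longrightarrow> lin_fun_on n (\<lambda>f. poly (T f) z)"
  by (simp add: lin_op_on_def lin_fun_on_def)

text \<open>Every zero is at distance at least r from \<open>z0\<close>, so moving by less than r at
  most doubles the distance to each of them. The constant depends on q only through its
  degree.\<close>

lemma norm_poly_le_of_nonvanishing:
  fixes q :: "complex poly"
  assumes "\<And>u. dist z0 u < r \<Longrightarrow> poly q u \<noteq> 0" and "dist z0 z < r"
  shows "norm (poly q z) \<le> 2 ^ degree q * norm (poly q z0)"
proof -
  obtain rt where rt: "smult (lead_coeff q) (\<Prod>i<degree q. [:-rt i, 1:]) = q"
    using complex_poly_decompose' by blast
  have ev: "poly q u = lead_coeff q * (\<Prod>i<degree q. u - rt i)" for u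
    by (subst rt[symmetric]) (simp add: poly_prod)
  have far: "norm (z - rt i) \<le> 2 * norm (z0 - rt i)" if "i < degree q" for i
  proof -
    have "poly q (rt i) = 0"
      using that by (auto simp: ev)
    then have "r \<le> norm (z0 - rt i)"
      using assms(1)[of "rt i"] by (force simp: dist_norm)
    moreover have "norm (z - rt i) \<le> norm (z - z0) + norm (z0 - rt i)"
      using norm_triangle_ineq[of "z - z0" "z0 - rt i"] by simp
    ultimately show ?thesis
      using assms(2) by (simp add: dist_norm norm_minus_commute)
  qed
  have "(\<Prod>i<degree q. norm (z - rt i)) \<le> (\<Prod>i<degree q. 2 * norm (z0 - rt i))"
    using far by (intro prod_mono) auto
  also have "\<dots> = 2 ^ degree q * (\<Prod>i<degree q. norm (z0 - rt i))"
    by (simp add: prod.distrib)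
  finally have le: "(\<Prod>i<degree q. norm (z - rt i)) \<le> \<dots>" .
  have "norm (poly q z) = norm (lead_coeff q) * (\<Prod>i<degree q. norm (z - rt i))"
    by (simp only: ev norm_mult prod_norm)
  also have "\<dots> \<le> norm (lead_coeff q) * (2 ^ degree q * (\<Prod>i<degree q. norm (z0 - rt i)))"
    using le by (intro mult_left_mono) auto
  also have "\<dots> = 2 ^ degree q * norm (poly q z0)"
    by (simp only: ev norm_mult prod_norm mult_ac)
  finally show ?thesis .
qed

text \<open>Hurwitz's theorem for bounded degree. The preceding estimate has the uniform constant
  \<open>2 ^ N\<close>, so it survives a merely pointwise limit and forces p to vanish on a whole
  ball around \<open>z0\<close>.\<close>

lemma poly_limit_nonvanishing:
  fixes q :: "nat \<Rightarrow> complex poly" and p :: "complex poly"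
  assumes deg: "\<And>k. degree (q k) \<le> N"
    and nz: "\<And>k u. u \<in> U \<Longrightarrow> poly (q k) u \<noteq> 0"
    and lim: "\<And>u. u \<in> U \<Longrightarrow> (\<lambda>k. poly (q k) u) \<longlonglongrightarrow> poly p u"
    and U: "open U" "z0 \<in> U" and z0: "poly p z0 = 0"
  shows "p = 0"
proof -
  obtain r where r: "r > 0" "ball z0 r \<subseteq> U"
    using U by (meson open_contains_ball)
  have "poly p z = 0" if z: "z \<in> ball z0 r" for z
  proof -
    have bd: "norm (poly (q k) z) \<le> 2 ^ N * norm (poly (q k) z0)" for k
    proof -
      have "norm (poly (q k) z) \<le> 2 ^ degree (q k) * norm (poly (q k) z0)"
        using r z nz by (intro norm_poly_le_of_nonvanishing[of _ r]) auto
      also have "\<dots> \<le> 2 ^ N * norm (poly (q k) z0)"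
        using deg by (intro mult_right_mono power_increasing) auto
      finally show ?thesis .
    qed
    have "norm (poly p z) \<le> 2 ^ N * norm (poly p z0)"
      by (rule LIMSEQ_le[of "\<lambda>k. norm (poly (q k) z)" _ "\<lambda>k. 2 ^ N * norm (poly (q k) z0)"])
         (use r z U lim bd in \<open>auto intro!: tendsto_norm tendsto_mult_left\<close>)
    then show ?thesis using z0 by simp
  qed
  then have "ball z0 r \<subseteq> {z. poly p z = 0}" by auto
  moreover have "infinite (ball z0 r)"
    using r uncountable_ball countable_finite by blast
  ultimately show ?thesis
    using poly_roots_finite[of p] finite_subset by blast
qed

section \<open>Laguerre's theorem on polar derivatives\<close>

lemma poly_pderiv_prod_linear:
  fixes w :: complex and m :: nat
  assumes "\<And>i. i < m \<Longrightarrow> w \<noteq> rt i"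
  shows "poly (pderiv (\<Prod>i<m. [:- rt i, 1:])) w =
    poly (\<Prod>i<m. [:- rt i, 1:]) w * (\<Sum>i<m. 1 / (w - rt i))"
  using assms
proof (induction m)
  case (Suc m)
  define A where "A = (\<Prod>i<m. [:- rt i, 1:])"
  have "w - rt m \<noteq> 0" using Suc.prems[of m] by simp
  moreover have "poly (pderiv A) w = poly A w * (\<Sum>i<m. 1 / (w - rt i))"
    using Suc by (simp add: A_def)
  moreover have "(\<Prod>i<Suc m. [:- rt i, 1:]) = A * [:- rt m, 1:]"
    by (simp add: A_def)
  ultimately show ?case
    by (simp only: pderiv_mult pderiv_pCons poly_mult poly_add sum.lessThan_Suc)
       (simp add: field_simps)
qed simp

text \<open>The Moebius map \<open>u \<mapsto> 1 / (w - u)\<close> sends the closed lower half plane and \<open>\<infinity>\<close> to the disc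
  \<open>{v. \<bar>v\<bar>\<^sup>2 Im w + Im v \<le> 0}\<close>, whose convexity is what excludes the value at \<open>s\<close>.\<close>

lemma laguerre_polar_derivative:
  fixes g :: "complex poly"
  assumes deg: "degree g \<le> n" and n: "n > 0"
    and nz: "\<And>u. Im u > 0 \<Longrightarrow> poly g u \<noteq> 0"
    and s: "Im s > 0" and w: "Im w > 0"
  shows "of_nat n * poly g w \<noteq> (w - s) * poly (pderiv g) w"
proof
  assume eq: "of_nat n * poly g w = (w - s) * poly (pderiv g) w"
  obtain rt where rt: "smult (lead_coeff g) (\<Prod>i<degree g. [:-rt i, 1:]) = g"
    using complex_poly_decompose' by blast
  define m where "m = degree g"
  have ev: "poly g u = lead_coeff g * (\<Prod>i<m. u - rt i)" for u
    unfolding m_def by (subst rt[symmetric]) (simp add: poly_prod)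
  have Imrt: "Im (rt i) \<le> 0" if "i < m" for i
    using nz[of "rt i"] that by (fastforce simp: ev)
  have wrt: "w \<noteq> rt i" if "i < m" for i
    using Imrt[OF that] w by auto
  define v where "v i = 1 / (w - rt i)" for i
  \<comment> \<open>S is the logarithmic derivative of g at w, so the equality to be refuted says S
    = n / (w - s).\<close>
  define S where "S = (\<Sum>i<m. v i)"
  have "poly (pderiv g) w = poly g w * S"
  proof -
    have "poly (pderiv g) w = lead_coeff g * poly (pderiv (\<Prod>i<m. [:-rt i, 1:])) w"
      unfolding m_def by (subst rt[symmetric]) (simp only: pderiv_smult poly_smult)
    also have "\<dots> = poly g w * S"
      using poly_pderiv_prod_linear[OF wrt] by (simp add: ev poly_prod S_def v_def)
    finally show ?thesis .
  qed
  then have S: "(w - s) * S = of_nat n"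
    using eq nz[OF w] by (simp add: mult_ac)
  have vi: "(norm (v i))\<^sup>2 * Im w + Im (v i) \<le> 0" if "i < m" for i
  proof -
    have pos: "norm (w - rt i) > 0" using wrt[OF that] by simp
    have "Im (v i) = - (Im w - Im (rt i)) / (norm (w - rt i))\<^sup>2"
      by (simp add: v_def Im_divide cmod_power2)
    then have "(norm (v i))\<^sup>2 * Im w + Im (v i) = Im (rt i) / (norm (w - rt i))\<^sup>2"
      using pos by (simp add: v_def norm_divide power_divide field_simps)
    then show ?thesis using Imrt[OF that] by (simp add: divide_nonpos_nonneg)
  qed
  have ImS: "Im S \<le> 0"
    unfolding S_def Im_sum
  proof (rule sum_nonpos)
    fix i assume "i \<in> {..<m}"
    then show "Im (v i) \<le> 0"
      using vi[of i] w by (smt (verit) lessThan_iff mult_nonneg_nonneg zero_le_power2)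
  qed
  \<comment> \<open>Convexity of the disc in the form of Cauchy-Schwarz: the average of the m points
    \<open>v i\<close> stays inside. Afterwards m is raised to n by means of \<open>ImS\<close>,
    which amounts to adding n - m zeros at \<infinity>, all sent to 0.\<close>
  have "(norm S)\<^sup>2 \<le> (\<Sum>i<m. norm (v i))\<^sup>2"
    unfolding S_def by (intro power_mono norm_sum) auto
  also have "\<dots> \<le> real m * (\<Sum>i<m. (norm (v i))\<^sup>2)"
    using sum_squared_le_sum_of_squares[of "\<lambda>i. norm (v i)" "{..<m}"] by (simp add: mult.commute)
  finally have "(norm S)\<^sup>2 * Im w \<le> real m * (\<Sum>i<m. (norm (v i))\<^sup>2) * Im w"
    using w by (intro mult_right_mono) auto
  also have "\<dots> = real m * (\<Sum>i<m. (norm (v i))\<^sup>2 * Im w)"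
    by (simp add: sum_distrib_right)
  also have "\<dots> \<le> real m * (\<Sum>i<m. - Im (v i))"
    using vi by (intro mult_left_mono sum_mono) (fastforce simp: algebra_simps)+
  also have "\<dots> = real m * - Im S"
    by (simp add: S_def sum_negf)
  also have "\<dots> \<le> real n * - Im S"
    using deg ImS by (intro mult_right_mono) (auto simp: m_def)
  finally have le: "(norm S)\<^sup>2 * Im w + real n * Im S \<le> 0" by simp
  have ws: "w \<noteq> s" using S n by auto
  then have Seq: "S = of_nat n / (w - s)"
    using S by (simp add: field_simps)
  have pos: "norm (w - s) > 0" using ws by simp
  have im: "Im S = - real n * (Im w - Im s) / (norm (w - s))\<^sup>2"
    by (simp add: Seq Im_divide cmod_power2)
  have norm: "(norm S)\<^sup>2 = (real n)\<^sup>2 / (norm (w - s))\<^sup>2"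
    by (simp add: Seq norm_divide power_divide)
  \<comment> \<open>S / n is the image of s, and s lies above the real axis, so the defining
    expression of the disc has the wrong sign there.\<close>
  have "(norm S)\<^sup>2 * Im w + real n * Im S = (real n)\<^sup>2 * Im s / (norm (w - s))\<^sup>2"
    unfolding im norm by (simp add: power2_eq_square diff_divide_distrib algebra_simps)
  moreover have "\<dots> > 0" using pos n s by simp
  ultimately show False using le by linarith
qed

section \<open>Grace's theorem by successive polar derivatives\<close>

lemma pderiv_setsum: "pderiv (\<Sum>i\<in>A. f i) = (\<Sum>i\<in>A. pderiv (f i))"
  by (induction A rule: infinite_finite_induct) (simp_all add: pderiv_add)

lemma linear_power_expansion:
  fixes w :: "'a :: comm_ring_1"
  shows "[:w, 1:] ^ m = (\<Sum>j\<le>m. smult (of_nat (m choose j) * w ^ j) ([:0, 1:] ^ (m - j)))"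
proof -
  have "[:w, 1:] = [:w:] + [:0, 1:]" by simp
  also have "\<dots> ^ m = (\<Sum>j\<le>m. of_nat (m choose j) * [:w:] ^ j * [:0, 1:] ^ (m - j))"
    by (rule binomial_ring)
  also have "\<dots> = (\<Sum>j\<le>m. smult (of_nat (m choose j) * w ^ j) ([:0, 1:] ^ (m - j)))"
    by (intro sum.cong refl) (simp add: of_nat_poly poly_const_pow mult_ac)
  finally show ?thesis .
qed

lemma lin_fun_on_linear_power:
  assumes L: "lin_fun_on n L" and deg: "degree F + m \<le> n"
  shows "L (F * [:w, 1:] ^ m) = (\<Sum>j\<le>m. of_nat (m choose j) * w ^ j * L (F * [:0, 1:] ^ (m - j)))"
proof -
  have "F * [:w, 1:] ^ m =
      (\<Sum>j\<le>m. smult (of_nat (m choose j) * w ^ j) (F * [:0, 1:] ^ (m - j)))"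
    by (subst linear_power_expansion) (simp add: sum_distrib_left mult_smult_right)
  also have "L \<dots> = (\<Sum>j\<le>m. of_nat (m choose j) * w ^ j * L (F * [:0, 1:] ^ (m - j)))"
  proof (rule lin_fun_on_sum[OF L])
    fix j assume "j \<in> {..m}"
    have "degree (F * [:0, 1:] ^ (m - j)) \<le> degree F + (m - j)"
      by (rule order_trans[OF degree_mult_le]) (simp add: degree_power_eq)
    then show "degree (F * [:0, 1:] ^ (m - j)) \<le> n"
      using deg by simp
  qed simp
  finally show ?thesis .
qed

text \<open>Differentiation in the parameter w lowers the power of z + w by one. This makes
  Laguerre's theorem applicable in the variable w, although L acts on z.\<close>

lemma lin_fun_on_linear_power_poly:
  assumes L: "lin_fun_on n L" and deg: "degree F + Suc m \<le> n"
  obtains g where "degree g \<le> Suc m"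
    and "\<And>w. poly g w = L (F * [:w, 1:] ^ Suc m)"
    and "\<And>w. poly (pderiv g) w = of_nat (Suc m) * L (F * [:w, 1:] ^ m)"
proof -
  define g where "g = (\<Sum>j\<le>Suc m. monom (of_nat (Suc m choose j) * L (F * [:0, 1:] ^ (Suc m - j))) j)"
  show ?thesis
  proof
    show "degree g \<le> Suc m"
      unfolding g_def by (intro degree_sum_le) (auto intro: order_trans[OF degree_monom_le])
    show "poly g w = L (F * [:w, 1:] ^ Suc m)" for w
      unfolding g_def lin_fun_on_linear_power[OF L deg]
      by (simp only: poly_sum poly_monom mult_ac)
    have deg': "degree F + m \<le> n" using deg by simp
    have bin: "of_nat (Suc j) * of_nat (Suc m choose Suc j) = (of_nat (Suc m) * of_nat (m choose j) :: complex)" for j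
      by (metis Suc_times_binomial of_nat_mult)
    have "poly (pderiv g) w =
        (\<Sum>j\<le>Suc m. of_nat j * of_nat (Suc m choose j) * L (F * [:0, 1:] ^ (Suc m - j)) * w ^ (j - 1))" for w
      unfolding g_def pderiv_setsum
      by (simp only: poly_sum poly_monom pderiv_monom mult_ac)
    also have "\<dots> w = (\<Sum>j\<le>m. of_nat (Suc j) * of_nat (Suc m choose Suc j) *
        L (F * [:0, 1:] ^ (m - j)) * w ^ j)" for w
      by (subst sum.atMost_Suc_shift) simp
    also have "\<dots> w = of_nat (Suc m) * L (F * [:w, 1:] ^ m)" for w
      unfolding bin lin_fun_on_linear_power[OF L deg'] sum_distrib_left
      by (simp only: mult_ac)
    finally show "poly (pderiv g) w = of_nat (Suc m) * L (F * [:w, 1:] ^ m)" for w .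
  qed
qed

text \<open>The factors z + w are exchanged for z - \<zeta> one at a time. Since z - \<zeta> = (z +
  w) - (w + \<zeta>), each exchange turns g(w) into g(w) - (w + \<zeta>) g'(w) / (m + 1), a polar
  derivative with pole -\<zeta> in the upper half plane, and so it preserves nonvanishing for all w
  there.\<close>

lemma grace_half_plane:
  assumes L: "lin_fun_on n L"
    and nz: "\<And>w. Im w > 0 \<Longrightarrow> L ([:w, 1:] ^ n) \<noteq> 0"
    and \<zeta>: "\<And>i. i < n \<Longrightarrow> Im (\<zeta> i) < 0"
  shows "L (\<Prod>i<n. [:- \<zeta> i, 1:]) \<noteq> 0"
proof -
  have "L ((\<Prod>i<k. [:- \<zeta> i, 1:]) * [:w, 1:] ^ (n - k)) \<noteq> 0" if "k \<le> n" "Im w > 0" for k w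
    using that
  proof (induction k arbitrary: w)
    case 0
    then show ?case using nz by simp
  next
    case (Suc k)
    define F where "F = (\<Prod>i<k. [:- \<zeta> i, 1:])"
    obtain m where m: "n - k = Suc m" "n - Suc k = m"
      using Suc.prems by (metis Suc_diff_Suc Suc_le_lessD)
    have dF: "degree F = k"
      unfolding F_def by (subst degree_prod_sum_eq) auto
    have deg: "degree F + Suc m \<le> n" using m Suc.prems dF by simp
    obtain g where g: "degree g \<le> Suc m" "\<And>w. poly g w = L (F * [:w, 1:] ^ Suc m)"
      "\<And>w. poly (pderiv g) w = of_nat (Suc m) * L (F * [:w, 1:] ^ m)"
      using lin_fun_on_linear_power_poly[OF L deg] by blast
    have "of_nat (Suc m) * poly g w \<noteq> (w - (- \<zeta> k)) * poly (pderiv g) w"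
    proof (rule laguerre_polar_derivative[OF g(1)])
      show "poly g u \<noteq> 0" if "Im u > 0" for u
        using Suc.IH[of u] Suc.prems that by (simp add: g(2) m F_def)
      show "0 < Im (- \<zeta> k)" using \<zeta>[of k] Suc.prems by simp
    qed (use Suc.prems in auto)
    then have ne: "poly g w \<noteq> (w + \<zeta> k) * L (F * [:w, 1:] ^ m)"
      by (auto simp: g(3) mult_ac simp del: of_nat_Suc)
    have "(\<Prod>i<Suc k. [:- \<zeta> i, 1:]) * [:w, 1:] ^ m
        = F * [:w, 1:] ^ Suc m + smult (- (w + \<zeta> k)) (F * [:w, 1:] ^ m)"
    proof -
      have "[:- \<zeta> k, 1:] = [:w, 1:] + [:- (w + \<zeta> k):]" by simp
      then have "(\<Prod>i<Suc k. [:- \<zeta> i, 1:]) * [:w, 1:] ^ m =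
          F * ([:w, 1:] + [:- (w + \<zeta> k):]) * [:w, 1:] ^ m"
        by (simp add: F_def)
      also have "\<dots> = F * [:w, 1:] ^ Suc m + [:- (w + \<zeta> k):] * (F * [:w, 1:] ^ m)"
        by (simp only: power_Suc algebra_simps)
      finally show ?thesis by simp
    qed
    moreover have "degree (F * [:w, 1:] ^ Suc m) \<le> n"
      by (rule order_trans[OF degree_mult_le]) (use deg in \<open>simp add: degree_power_eq del: power_Suc\<close>)
    moreover have "degree (F * [:w, 1:] ^ m) \<le> n"
      by (rule order_trans[OF degree_mult_le]) (use deg in \<open>simp add: degree_power_eq\<close>)
    moreover have "degree (smult (- (w + \<zeta> k)) (F * [:w, 1:] ^ m)) \<le> n"
      by (rule order_trans[OF degree_smult_le]) fact
    ultimately have "L ((\<Prod>i<Suc k. [:- \<zeta> i, 1:]) * [:w, 1:] ^ m)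
        = poly g w - (w + \<zeta> k) * L (F * [:w, 1:] ^ m)"
      using L unfolding lin_fun_on_def Cn_def g(2) by (metis (no_types, lifting) mem_Collect_eq mult_minus_left uminus_add_conv_diff add.commute)
    then show ?case using ne m by simp
  qed
  \<comment> \<open>After n exchanges no power of z + w is left, so any w in the upper half plane
    serves.\<close>
  from this[of n \<i>] show ?thesis by simp
qed

section \<open>Stable symbols give preservers\<close>

lemma tendsto_coeff_prod:
  fixes p :: "'i \<Rightarrow> nat \<Rightarrow> complex poly"
  assumes "finite A" "\<And>i j. i \<in> A \<Longrightarrow> (\<lambda>k. coeff (p i k) j) \<longlonglongrightarrow> coeff (q i) j"
  shows "(\<lambda>k. coeff (\<Prod>i\<in>A. p i k) j) \<longlonglongrightarrow> coeff (\<Prod>i\<in>A. q i) j"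
  using assms
proof (induction A arbitrary: j rule: finite_induct)
  case (insert x F)
  then show ?case
    by (simp add: coeff_mult) (intro tendsto_intros; simp)
qed simp

text \<open>Perturbing the real zeros and the zeros at infinity of \<open>f\<close> into the open lower half plane makes
  Grace's theorem applicable; the limit recovers \<open>T f\<close>.\<close>

lemma stable_symbol_preserves_upper:
  assumes T: "lin_op_on n T"
    and nz: "\<And>z w. Im z > 0 \<Longrightarrow> Im w > 0 \<Longrightarrow> poly (T ([:w, 1:] ^ n)) z \<noteq> 0"
    and f: "degree f \<le> n" "\<And>u. poly f u = 0 \<Longrightarrow> u \<in> \<real>"
    and z0: "Im z0 > 0" "poly (T f) z0 = 0"
  shows "T f = 0"
proof (cases "f = 0")
  case True
  then show ?thesis using lin_op_on_0[OF T] by simp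
next
  case False
  define d where "d = degree f"
  obtain rt where rt: "smult (lead_coeff f) (\<Prod>i<d. [:-rt i, 1:]) = f"
    unfolding d_def using complex_poly_decompose' by blast
  have root: "rt i \<in> \<real>" if "i < d" for i
  proof (rule f(2))
    show "poly f (rt i) = 0"
      using that by (subst rt[symmetric]) (auto simp: poly_prod)
  qed
  define \<epsilon> where "\<epsilon> k = inverse (real (Suc k))" for k
  have \<epsilon>pos: "\<epsilon> k > 0" for k by (simp add: \<epsilon>_def)
  have \<epsilon>lim: "\<epsilon> \<longlonglongrightarrow> 0"
    unfolding \<epsilon>_def by (rule LIMSEQ_inverse_real_of_nat)
  \<comment> \<open>The zero \<open>rt i\<close> moves down to \<open>rt i\<close> - \<i>\<epsilon>.
    Each of the n - d missing factors 1 becomes 1 - \<i>\<epsilon>z, whose zero -\<i>/\<epsilon>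
    comes in from infinity through the lower half plane.\<close>
  define a where "a i k = (if i < d then [:- rt i + \<i> * of_real (\<epsilon> k), 1:] else [:1, - \<i> * of_real (\<epsilon> k):])" for i k
  define b where "b i = (if i < d then [:- rt i, 1:] else 1)" for i
  define q where "q k = smult (lead_coeff f) (\<Prod>i<n. a i k)" for k
  have prod_b: "(\<Prod>i<n. b i) = (\<Prod>i<d. [:- rt i, 1:])"
    by (rule prod.mono_neutral_cong_right) (use f(1) in \<open>auto simp: b_def d_def\<close>)
  have a_lim: "(\<lambda>k. coeff (a i k) j) \<longlonglongrightarrow> coeff (b i) j" for i j
  proof -
    consider "j = 0" | "j = 1" | "j \<ge> 2" by linarith
    then show ?thesis
      by cases (auto simp: a_def b_def coeff_pCons coeff_eq_0 split: nat.splits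
          intro!: tendsto_eq_intros \<epsilon>lim)
  qed
  have q_lim: "(\<lambda>k. coeff (q k) j) \<longlonglongrightarrow> coeff f j" for j
  proof -
    have "(\<lambda>k. coeff (\<Prod>i<n. a i k) j) \<longlonglongrightarrow> coeff (\<Prod>i<n. b i) j"
      by (rule tendsto_coeff_prod) (auto intro: a_lim)
    then have "(\<lambda>k. coeff (q k) j) \<longlonglongrightarrow> lead_coeff f * coeff (\<Prod>i<n. b i) j"
      unfolding q_def coeff_smult by (rule tendsto_mult_left)
    also have "lead_coeff f * coeff (\<Prod>i<n. b i) j = coeff f j"
      unfolding prod_b coeff_smult[symmetric] rt ..
    finally show ?thesis .
  qed
  have deg_a: "degree (a i k) \<le> 1" for i k by (simp add: a_def)
  have deg_q: "degree (q k) \<le> n" for k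
  proof -
    have "degree (\<Prod>i<n. a i k) \<le> (\<Sum>i<n. degree (a i k))"
      using degree_prod_sum_le[of "{..<n}" "\<lambda>i. a i k"] by (simp add: comp_def)
    also have "\<dots> \<le> (\<Sum>i<n. 1)" by (intro sum_mono deg_a)
    finally show ?thesis unfolding q_def by (intro order_trans[OF degree_smult_le]) simp
  qed
  have q_nz: "poly (T (q k)) u \<noteq> 0" if u: "Im u > 0" for k u
  proof -
    define \<zeta> where "\<zeta> i = (if i < d then rt i - \<i> * of_real (\<epsilon> k) else - \<i> / of_real (\<epsilon> k))" for i
    define e where "e i = (if i < d then 1 else - \<i> * of_real (\<epsilon> k))" for i
    have "a i k = [:e i:] * [:- \<zeta> i, 1:]" for i
      using \<epsilon>pos[of k] by (auto simp: a_def e_def \<zeta>_def)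
    then have "(\<Prod>i<n. a i k) = [:\<Prod>i<n. e i:] * (\<Prod>i<n. [:- \<zeta> i, 1:])"
      by (simp only: prod.distrib prod_to_poly)
    then have qk: "q k = smult (lead_coeff f * (\<Prod>i<n. e i)) (\<Prod>i<n. [:- \<zeta> i, 1:])"
      by (simp add: q_def)
    have "Im (\<zeta> i) < 0" for i
      using root[of i] \<epsilon>pos[of k] by (auto simp: \<zeta>_def complex_is_Real_iff Im_divide)
    then have "poly (T (\<Prod>i<n. [:- \<zeta> i, 1:])) u \<noteq> 0"
      using grace_half_plane[OF lin_fun_on_poly[OF T, of u], of \<zeta>] nz u by blast
    moreover have "degree (\<Prod>i<n. [:- \<zeta> i, 1:]) \<le> n"
      by (subst degree_prod_sum_eq) auto
    moreover have "(\<Prod>i<n. e i) \<noteq> 0"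
      using \<epsilon>pos[of k] by (auto simp: e_def)
    ultimately show ?thesis
      using False by (simp add: qk lin_op_on_smult[OF T])
  qed
  have Tf: "T f = (\<Sum>j\<le>n. smult (coeff f j) (T (monom 1 j)))"
    by (rule lin_op_on_monoms[OF T f(1)])
  have Tq: "T (q k) = (\<Sum>j\<le>n. smult (coeff (q k) j) (T (monom 1 j)))" for k
    by (rule lin_op_on_monoms[OF T deg_q])
  show ?thesis
  proof (rule poly_limit_nonvanishing[of "\<lambda>k. T (q k)" _ "{z. Im z > 0}" _ z0])
    fix k
    \<comment> \<open>The bound must not depend on k; the images of the monomials supply
      one.\<close>
    show "degree (T (q k)) \<le> (\<Sum>j\<le>n. degree (T (monom 1 j)))"
      unfolding Tq
      by (intro degree_sum_le order_trans[OF degree_smult_le] member_le_sum) auto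
  next
    fix u :: complex
    show "(\<lambda>k. poly (T (q k)) u) \<longlonglongrightarrow> poly (T f) u"
      unfolding Tf Tq poly_sum poly_smult
      by (intro tendsto_sum tendsto_mult_right q_lim)
  qed (use q_nz z0 in \<open>auto simp: open_halfspace_Im_gt\<close>)
qed

section \<open>Real polynomials and conjugate zeros\<close>

lemma poly_real_cnj: "real_poly p \<Longrightarrow> poly p (cnj z) = cnj (poly p z)"
  by (simp add: real_poly_def poly_cnj_real)

lemma real_poly_0 [simp]: "real_poly 0"
  and real_poly_1 [simp]: "real_poly 1"
  and real_poly_pCons [simp]: "real_poly (pCons c p) \<longleftrightarrow> c \<in> \<real> \<and> real_poly p"
  and real_poly_add: "real_poly p \<Longrightarrow> real_poly q \<Longrightarrow> real_poly (p + q)"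
  and real_poly_mult: "real_poly p \<Longrightarrow> real_poly q \<Longrightarrow> real_poly (p * q)"
  and real_poly_smult: "c \<in> \<real> \<Longrightarrow> real_poly p \<Longrightarrow> real_poly (smult c p)"
  and real_poly_monom [simp]: "real_poly (monom 1 j)"
  by (auto simp: real_poly_def coeff_mult coeff_pCons split: nat.splits if_splits)

lemma real_poly_sum: "(\<And>i. i \<in> A \<Longrightarrow> real_poly (f i)) \<Longrightarrow> real_poly (\<Sum>i\<in>A. f i)"
  by (induction A rule: infinite_finite_induct) (auto intro: real_poly_add)

lemma real_poly_prod: "(\<And>i. i \<in> A \<Longrightarrow> real_poly (f i)) \<Longrightarrow> real_poly (\<Prod>i\<in>A. f i)"
  by (induction A rule: infinite_finite_induct) (auto intro: real_poly_mult)

text \<open>Dividing by the leading coefficient leaves a product of real linear factors. This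
  reduces statements about complex real-rooted polynomials to real ones.\<close>

lemma real_rooted_smult_real:
  fixes f :: "complex poly"
  assumes "\<And>u. poly f u = 0 \<Longrightarrow> u \<in> \<real>"
  obtains g where "f = smult (lead_coeff f) g" "real_poly g" "degree g \<le> degree f"
proof -
  obtain rt where rt: "smult (lead_coeff f) (\<Prod>i<degree f. [:-rt i, 1:]) = f"
    using complex_poly_decompose' by blast
  have "rt i \<in> \<real>" if "i < degree f" for i
  proof (rule assms)
    show "poly f (rt i) = 0"
      using that by (subst rt[symmetric]) (auto simp: poly_prod)
  qed
  then have "real_poly (\<Prod>i<degree f. [:-rt i, 1:])"
    by (intro real_poly_prod) (simp add: Reals_minus)
  then show ?thesis using that[OF rt[symmetric]] by (simp add: degree_prod_sum_eq)
qed

lemma stable_symbol_preserves_real_rooted: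
  assumes T: "lin_op_on n T"
    and real: "\<And>h. degree h \<le> n \<Longrightarrow> real_poly h \<Longrightarrow> real_poly (T h)"
    and nz: "\<And>z w. Im z > 0 \<Longrightarrow> Im w > 0 \<Longrightarrow> poly (T ([:w, 1:] ^ n)) z \<noteq> 0"
    and f: "degree f \<le> n" "\<And>u. poly f u = 0 \<Longrightarrow> u \<in> \<real>"
    and z0: "poly (T f) z0 = 0" "z0 \<notin> \<real>"
  shows "T f = 0"
proof -
  note up = stable_symbol_preserves_upper[OF T nz f]
  obtain g where g: "f = smult (lead_coeff f) g" "real_poly g" "degree g \<le> degree f"
    using real_rooted_smult_real f(2) by metis
  have Tf: "T f = smult (lead_coeff f) (T g)"
    using lin_op_on_smult[OF T, of g "lead_coeff f"] g f(1) by simp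
  have "poly (T f) (cnj z0) = 0"
    using z0 real[of g] g f(1) by (auto simp: Tf poly_real_cnj)
  moreover have "Im z0 > 0 \<or> Im (cnj z0) > 0"
    using z0(2) by (auto simp: complex_is_Real_iff)
  ultimately show ?thesis using up z0(1) by blast
qed

section \<open>Interlacing and real pencils\<close>

text \<open>The argument in (0, \<pi>) of a point of the upper half plane. The arctangent form makes
  continuity and strict monotonicity under real translations immediate.\<close>

definition upper_arg :: "complex \<Rightarrow> real" where
  "upper_arg u = pi / 2 - arctan (Re u / Im u)"

lemma upper_arg_bounds: "0 < upper_arg u" "upper_arg u < pi"
  using arctan_bounded[of "Re u / Im u"] by (auto simp: upper_arg_def)

lemma upper_arg_polar:
  assumes "Im u > 0"
  shows "of_real (norm u) * cis (upper_arg u) = u"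
proof -
  define t where "t = Re u / Im u"
  have pos: "1 + t\<^sup>2 > 0" by (smt (verit) zero_le_power2)
  have "(norm u)\<^sup>2 = (Im u)\<^sup>2 * (1 + t\<^sup>2)"
    using assms by (simp add: t_def cmod_power2 power_divide field_simps)
  then have n: "norm u = Im u * sqrt (1 + t\<^sup>2)"
    using assms by (metis norm_ge_zero real_sqrt_mult real_sqrt_unique less_imp_le)
  have "cos (upper_arg u) = t / sqrt (1 + t\<^sup>2)" "sin (upper_arg u) = 1 / sqrt (1 + t\<^sup>2)"
    by (simp_all add: upper_arg_def t_def cos_diff sin_diff sin_arctan cos_arctan)
  then show ?thesis
    using pos assms by (simp add: complex_eq_iff n t_def)
qed

lemma upper_arg_strict_mono:
  assumes "Im z > 0" "s < t"
  shows "upper_arg (z - of_real s) < upper_arg (z - of_real t)"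
  using assms by (simp add: upper_arg_def arctan_less_iff divide_strict_right_mono)

lemma continuous_on_upper_arg: "continuous_on {u. Im u > 0} upper_arg"
  unfolding upper_arg_def by (intro continuous_intros) auto

lemma upper_arg_boundary:
  fixes x t :: real
  assumes "x \<noteq> t"
  shows "((\<lambda>\<epsilon>. upper_arg (Complex x \<epsilon> - of_real t)) \<longlongrightarrow> (if x < t then pi else 0)) (at_right 0)"
proof (cases "x < t")
  case True
  have "LIM \<epsilon> at_right 0. (x - t) * inverse \<epsilon> :> at_bot"
    by (rule filterlim_tendsto_neg_mult_at_bot[OF tendsto_const _ filterlim_inverse_at_top_right])
       (use True in simp)
  from filterlim_compose[OF tendsto_arctan_at_bot this]
  have "((\<lambda>\<epsilon>. pi / 2 - arctan ((x - t) * inverse \<epsilon>)) \<longlongrightarrow> pi / 2 - - (pi / 2)) (at_right 0)"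
    by (intro tendsto_diff tendsto_const)
  then show ?thesis using True by (simp add: upper_arg_def inverse_eq_divide)
next
  case False
  then have "x - t > 0" using assms by simp
  then have "LIM \<epsilon> at_right 0. (x - t) * inverse \<epsilon> :> at_top"
    by (rule filterlim_tendsto_pos_mult_at_top[OF tendsto_const _ filterlim_inverse_at_top_right])
  from filterlim_compose[OF tendsto_arctan_at_top this]
  have "((\<lambda>\<epsilon>. pi / 2 - arctan ((x - t) * inverse \<epsilon>)) \<longlongrightarrow> pi / 2 - (pi / 2)) (at_right 0)"
    by (intro tendsto_diff tendsto_const)
  then show ?thesis using False by (simp add: upper_arg_def inverse_eq_divide)
qed

text \<open>A continuous branch of the argument of \<open>root_poly xs\<close> on the upper half
  plane. It is not reduced modulo 2\<pi>, so its boundary values can count zeros.\<close>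

definition root_angle :: "real list \<Rightarrow> complex \<Rightarrow> real" where
  "root_angle xs z = (\<Sum>x\<leftarrow>xs. upper_arg (z - of_real x))"

definition root_poly :: "real list \<Rightarrow> complex poly" where
  "root_poly xs = (\<Prod>x\<leftarrow>xs. [:- of_real x, 1:])"

lemma root_poly_polar:
  assumes "Im z > 0"
  obtains r :: real where "r > 0" "poly (root_poly xs) z = of_real r * cis (root_angle xs z)"
proof -
  have "\<exists>r::real. r > 0 \<and> poly (root_poly xs) z = of_real r * cis (root_angle xs z)"
  proof (induction xs)
    case Nil
    then show ?case by (auto simp: root_poly_def root_angle_def intro!: exI[of _ 1])
  next
    case (Cons x xs)
    then obtain r :: real where r: "r > 0" "poly (root_poly xs) z = of_real r * cis (root_angle xs z)"
      by blast
    have im: "Im (z - of_real x) > 0" using assms by simp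
    have "poly (root_poly (x # xs)) z = (z - of_real x) * poly (root_poly xs) z"
      by (simp add: root_poly_def algebra_simps)
    also have "\<dots> = of_real (norm (z - of_real x)) * cis (upper_arg (z - of_real x)) *
        (of_real r * cis (root_angle xs z))"
      using upper_arg_polar[OF im] r by simp
    also have "\<dots> = of_real (norm (z - of_real x) * r) * cis (root_angle (x # xs) z)"
      by (simp add: root_angle_def cis_mult[symmetric] mult_ac)
    finally have "poly (root_poly (x # xs)) z = \<dots>" .
    moreover have "norm (z - of_real x) * r > 0" using im r by (intro mult_pos_pos) auto
    ultimately show ?case by blast
  qed
  then show ?thesis using that by blast
qed

lemma root_angle_eq_sum: "root_angle xs z = (\<Sum>i<length xs. upper_arg (z - of_real (xs ! i)))"
  by (simp add: root_angle_def sum_list_sum_nth atLeast0LessThan)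

lemma root_angle_boundary:
  assumes "x \<notin> set xs"
  shows "((\<lambda>\<epsilon>. root_angle xs (Complex x \<epsilon>)) \<longlongrightarrow> pi * real (length (filter (\<lambda>t. x < t) xs))) (at_right 0)"
  using assms
proof (induction xs)
  case (Cons t xs)
  then have "((\<lambda>\<epsilon>. upper_arg (Complex x \<epsilon> - of_real t) + root_angle xs (Complex x \<epsilon>)) \<longlongrightarrow>
      (if x < t then pi else 0) + pi * real (length (filter (\<lambda>t. x < t) xs))) (at_right 0)"
    by (intro tendsto_add upper_arg_boundary) auto
  moreover have "(if x < t then pi else 0) + pi * real (length (filter (\<lambda>t. x < t) xs))
      = pi * real (length (filter (\<lambda>t. x < t) (t # xs)))"
    by (simp add: algebra_simps)
  ultimately show ?case by (simp only: root_angle_def list.map sum_list.Cons)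
qed (simp add: root_angle_def)

text \<open>The description behind \<open>real_zeros\<close> has exactly one solution because all
  zeros are real: the multiset \<open>proots P\<close> then comes from a multiset of reals, and a
  multiset has only one sorted listing.\<close>

lemma real_zerosD:
  assumes "P \<in> H1R"
  shows "sorted (real_zeros P)" "P = smult (lead_coeff P) (root_poly (real_zeros P))"
proof -
  have P: "P \<noteq> 0" "\<And>z. poly P z = 0 \<Longrightarrow> z \<in> \<real>"
    using assms by (auto simp: H1R_def pi_set_def)
  define M where "M = image_mset Re (proots P)"
  have pM: "image_mset of_real M = proots P"
    unfolding M_def multiset.map_comp
    by (rule trans[OF multiset.map_cong0 multiset.map_ident]) (use P in \<open>auto simp: complex_is_Real_iff complex_eq_iff\<close>)
  have cnt: "count M r = order (complex_of_real r) P" for r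
  proof -
    have "count M r = count (image_mset complex_of_real M) (of_real r)"
      by (induction M) auto
    then show ?thesis using P(1) by (simp add: pM)
  qed
  have "real_zeros P = sorted_list_of_multiset M"
    unfolding real_zeros_def
  proof (rule the_equality)
    fix xs assume xs: "sorted xs \<and> (\<forall>r. count (mset xs) r = order (complex_of_real r) P)"
    then have "mset xs = M" by (intro multiset_eqI) (simp add: cnt)
    then show "xs = sorted_list_of_multiset M"
      using xs by (metis mset_sorted_list_of_multiset sorted_list_of_multiset_mset sorted_sort_id)
  qed (simp add: cnt)
  then have mz: "mset (real_zeros P) = M" and "sorted (real_zeros P)" by auto
  then show "sorted (real_zeros P)" by simp
  have "root_poly (real_zeros P) = (\<Prod>x\<in>#M. [:- complex_of_real x, 1:])"
    unfolding root_poly_def mz[symmetric] by (metis mset_map prod_mset_prod_list)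
  also have "\<dots> = (\<Prod>x\<in>#image_mset complex_of_real M. [:- x, 1:])"
    by (simp add: multiset.map_comp comp_def)
  finally show "P = smult (lead_coeff P) (root_poly (real_zeros P))"
    using complex_poly_decompose_multiset[of P] by (simp add: pM)
qed

text \<open>Here f stands for the angle contributed by a zero and M for \<pi>. The two inequalities
  of interlacing give two ways of pairing the entries. One pairing makes the paired differences
  nonnegative, the other makes them nonpositive, and each leaves at most one unpaired entry on
  either side. Coinciding entries are allowed, and D = 0 only occurs if all of them
  coincide.\<close>

lemma chain_interlace_sums:
  fixes f :: "real \<Rightarrow> real"
  assumes ci: "chain_interlace xs ys"
    and mono: "\<And>s t. s < t \<Longrightarrow> f s < f t"
    and bd: "\<And>t. 0 < f t" "\<And>t. f t < M"
  defines "D \<equiv> (\<Sum>i<length ys. f (ys ! i)) - (\<Sum>i<length xs. f (xs ! i))"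
  shows "xs = ys \<or> (0 < D \<and> D < M) \<or> (- M < D \<and> D < 0)"
proof -
  have le: "f s \<le> f t" if "s \<le> t" for s t
    using mono[of s t] that by (cases "s = t") auto
  note c = ci[unfolded chain_interlace_def]
  show ?thesis
  proof (cases "length ys = length xs")
    case True
    define p where "p = length xs"
    have D: "D = (\<Sum>i<p. f (ys ! i) - f (xs ! i))"
      by (simp add: D_def True p_def sum_subtractf)
    have nn: "f (ys ! i) - f (xs ! i) \<ge> 0" if "i \<in> {..<p}" for i
      using c that True by (auto simp: p_def intro: le)
    have "D \<ge> 0" unfolding D using nn by (rule sum_nonneg)
    moreover have "xs = ys" if "D = 0"
    proof (rule nth_equalityI)
      fix i assume i: "i < length xs"
      have "\<forall>i\<in>{..<p}. f (ys ! i) - f (xs ! i) = 0"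
        using that unfolding D by (subst (asm) sum_nonneg_eq_0_iff) (use nn in auto)
      then have "f (ys ! i) = f (xs ! i)" using i by (simp add: p_def)
      then show "xs ! i = ys ! i"
        using mono[of "xs ! i" "ys ! i"] mono[of "ys ! i" "xs ! i"] by (cases "xs ! i" "ys ! i" rule: linorder_cases) auto
    qed (simp add: True)
    moreover have "D < M" if "xs \<noteq> ys"
    proof -
      have "p \<noteq> 0" using that True by (auto simp: p_def)
      then obtain m where m: "p = Suc m" using not0_implies_Suc by blast
      have "D = (\<Sum>i<Suc m. f (ys ! i)) - (\<Sum>i<Suc m. f (xs ! i))"
        by (simp add: D_def True p_def[symmetric] m)
      also have "\<dots> = f (ys ! m) - f (xs ! 0) + (\<Sum>i<m. f (ys ! i) - f (xs ! Suc i))"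
        by (subst (2) sum.lessThan_Suc_shift) (simp add: sum_subtractf)
      also have "(\<Sum>i<m. f (ys ! i) - f (xs ! Suc i)) \<le> 0"
      proof (rule sum_nonpos)
        fix i assume "i \<in> {..<m}"
        then show "f (ys ! i) - f (xs ! Suc i) \<le> 0"
          using c True m by (auto simp: p_def intro!: le)
      qed
      finally show ?thesis using bd(1)[of "xs ! 0"] bd(2)[of "ys ! m"] by linarith
    qed
    ultimately show ?thesis by fastforce
  next
    case False
    define m where "m = length ys"
    have lx: "length xs = Suc m" using False c by (simp add: m_def)
    have "D = (\<Sum>i<m. f (ys ! i)) - (\<Sum>i<Suc m. f (xs ! i))"
      by (simp add: D_def lx m_def[symmetric])
    also have "\<dots> = (\<Sum>i<m. f (ys ! i) - f (xs ! Suc i)) - f (xs ! 0)"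
      by (subst sum.lessThan_Suc_shift) (simp add: sum_subtractf)
    also have "(\<Sum>i<m. f (ys ! i) - f (xs ! Suc i)) \<le> 0"
    proof (rule sum_nonpos)
      fix i assume "i \<in> {..<m}"
      then show "f (ys ! i) - f (xs ! Suc i) \<le> 0"
        using c lx by (auto simp: m_def intro!: le)
    qed
    finally have "D < 0" using bd(1)[of "xs ! 0"] by linarith
    have "(\<Sum>i<m. f (ys ! i) - f (xs ! i)) \<ge> 0"
    proof (rule sum_nonneg)
      fix i assume "i \<in> {..<m}"
      then show "f (ys ! i) - f (xs ! i) \<ge> 0"
        using c lx by (auto simp: m_def intro!: le)
    qed
    moreover have "D = (\<Sum>i<m. f (ys ! i) - f (xs ! i)) - f (xs ! m)"
      by (simp add: D_def lx m_def[symmetric] sum_subtractf)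
    ultimately have "- M < D" using bd(2)[of "xs ! m"] by linarith
    then show ?thesis using \<open>D < 0\<close> by blast
  qed
qed

lemma cis_combination_eq_0:
  fixes r s a b :: real
  assumes "of_real r * cis a + of_real s * cis b = 0" "sin (b - a) \<noteq> 0"
  shows "r = 0 \<and> s = 0"
proof -
  have "of_real r + of_real s * cis (b - a) = cis (- a) * (of_real r * cis a + of_real s * cis b)"
    by (simp add: distrib_left mult.left_commute[of "cis (- a)"] cis_mult)
  then have e: "of_real r + of_real s * cis (b - a) = 0"
    using assms(1) by simp
  then have "s * sin (b - a) = 0"
    by (simp add: complex_eq_iff)
  then show ?thesis using e assms(2) by simp
qed

text \<open>The angle between the two values is strictly between consecutive multiples of \<pi>, so
  they are linearly independent over the reals and a = b = 0. Only equal lists escape this, and then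
  a + b = 0; the conclusion covers both cases.\<close>

lemma chain_interlace_combination:
  fixes a b :: real
  assumes ci: "chain_interlace xs ys" and z: "Im z > 0"
    and eq: "of_real a * poly (root_poly xs) z + of_real b * poly (root_poly ys) z = 0"
  shows "smult (of_real a) (root_poly xs) + smult (of_real b) (root_poly ys) = 0"
proof (cases "xs = ys")
  case True
  obtain r where r: "r > 0" "poly (root_poly ys) z = of_real r * cis (root_angle ys z)"
    using root_poly_polar[OF z] .
  have "of_real (a + b) * poly (root_poly ys) z = 0"
    using eq True by (simp add: algebra_simps)
  then have "complex_of_real (a + b) = 0" using r by simp
  then show ?thesis using True by (metis of_real_add smult_0_left smult_add_left)
next
  case False
  obtain r where r: "r > 0" "poly (root_poly xs) z = of_real r * cis (root_angle xs z)"
    using root_poly_polar[OF z] .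
  obtain s where s: "s > 0" "poly (root_poly ys) z = of_real s * cis (root_angle ys z)"
    using root_poly_polar[OF z] .
  define D where "D = root_angle ys z - root_angle xs z"
  have "(0 < D \<and> D < pi) \<or> (- pi < D \<and> D < 0)"
    using chain_interlace_sums[OF ci, of "\<lambda>t. upper_arg (z - of_real t)" pi] False
      upper_arg_strict_mono[OF z] upper_arg_bounds
    by (auto simp: root_angle_eq_sum D_def)
  then have "sin D \<noteq> 0"
    using sin_gt_zero[of D] sin_gt_zero[of "- D"] by auto
  then have "a * r = 0 \<and> b * s = 0"
    using cis_combination_eq_0[of "a * r" "root_angle xs z" "b * s" "root_angle ys z"] eq r s
    by (simp add: D_def mult_ac)
  then show ?thesis using r s by simp
qed

lemma real_poly_lead_coeff: "real_poly P \<Longrightarrow> lead_coeff P = of_real (Re (lead_coeff P))"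
  by (simp add: real_poly_def complex_is_Real_iff complex_eq_iff)

lemma interlace_combination:
  fixes a b :: real
  assumes P: "P \<in> H1R" and Q: "Q \<in> H1R" and il: "zeros_interlace P Q" and z: "Im z > 0"
    and eq: "of_real a * poly P z + of_real b * poly Q z = 0"
  shows "smult (of_real a) P + smult (of_real b) Q = 0"
proof -
  have rP: "real_poly P" and rQ: "real_poly Q" using P Q by (auto simp: H1R_def)
  define p where "p = Re (lead_coeff P)"
  define q where "q = Re (lead_coeff Q)"
  have Pe: "P = smult (of_real p) (root_poly (real_zeros P))"
    using real_zerosD(2)[OF P] real_poly_lead_coeff[OF rP] by (simp add: p_def)
  have Qe: "Q = smult (of_real q) (root_poly (real_zeros Q))"
    using real_zerosD(2)[OF Q] real_poly_lead_coeff[OF rQ] by (simp add: q_def)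
  have eq': "of_real (a * p) * poly (root_poly (real_zeros P)) z + of_real (b * q) * poly (root_poly (real_zeros Q)) z = 0"
    using eq arg_cong[OF Pe, of "\<lambda>p. poly p z"] arg_cong[OF Qe, of "\<lambda>p. poly p z"] by (simp add: mult.assoc)
  have fin: "smult (of_real a) P + smult (of_real b) Q = smult (of_real (a * p)) (root_poly (real_zeros P))
      + smult (of_real (b * q)) (root_poly (real_zeros Q))"
    by (subst Pe, subst Qe) simp
  from il consider "degree P \<le> 1" "degree Q \<le> 1"
    | "chain_interlace (real_zeros P) (real_zeros Q)" | "chain_interlace (real_zeros Q) (real_zeros P)"
    unfolding zeros_interlace_def by blast
  then show ?thesis
  proof cases
    \<comment> \<open>The convention for degrees 0 and 1 says nothing about the order of the zeros,
      but a real polynomial of degree at most 1 with a non-real zero is 0 anyway.\<close>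
    case 1
    define F where "F = smult (of_real a) P + smult (of_real b) Q"
    have dF: "degree F \<le> 1"
      unfolding F_def using 1 by (intro degree_add_le order_trans[OF degree_smult_le])
    have rF: "real_poly F"
      unfolding F_def using rP rQ by (intro real_poly_add real_poly_smult) auto
    obtain c d where cd: "F = [:c, d:]"
    proof
      show "F = [:coeff F 0, coeff F 1:]"
        by (rule poly_eqI) (use dF in \<open>auto simp: coeff_pCons coeff_eq_0 split: nat.splits\<close>)
    qed
    have "c + z * d = 0"
      using eq cd F_def by (metis (no_types, lifting) add.right_neutral mult_zero_right poly_0 poly_add poly_pCons poly_smult)
    moreover have "Im c = 0" "Im d = 0"
      using rF cd by (auto simp: complex_is_Real_iff)
    ultimately have "d = 0" "c = 0" using z by (auto simp: complex_eq_iff)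
    then show ?thesis using cd F_def by simp
  next
    case 2
    then show ?thesis using chain_interlace_combination[OF _ z eq'] fin by simp
  next
    case 3
    then show ?thesis using chain_interlace_combination[OF 3 z, of "b * q" "a * p"] eq' fin
      by (simp add: add.commute)
  qed
qed

section \<open>Recovering interlacing from zero counts\<close>

lemma sorted_filter_greater_length:
  fixes xs :: "real list"
  assumes "sorted xs" "i < length xs"
  shows "x < xs ! i \<Longrightarrow> length xs \<le> length (filter (\<lambda>t. x < t) xs) + i"
    and "xs ! i < x \<Longrightarrow> length (filter (\<lambda>t. x < t) xs) + i < length xs"
proof -
  have f: "length (filter (\<lambda>t. x < t) xs) = card {j. j < length xs \<and> x < xs ! j}"
    by (rule length_filter_conv_card)
  {
    assume x: "x < xs ! i"
    have "{i..<length xs} \<subseteq> {j. j < length xs \<and> x < xs ! j}"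
      using x assms sorted_nth_mono[OF assms(1), of i] by fastforce
    from card_mono[OF _ this] show "length xs \<le> length (filter (\<lambda>t. x < t) xs) + i"
      unfolding f by simp
  next
    assume x: "xs ! i < x"
    have "{j. j < length xs \<and> x < xs ! j} \<subseteq> {Suc i..<length xs}"
    proof clarsimp
      fix j assume j: "j < length xs" "x < xs ! j"
      show "Suc i \<le> j"
      proof (rule ccontr)
        assume "\<not> Suc i \<le> j"
        then have "xs ! j \<le> xs ! i" using assms by (intro sorted_nth_mono) auto
        then show False using x j by simp
      qed
    qed
    from card_mono[OF _ this] show "length (filter (\<lambda>t. x < t) xs) + i < length xs"
      unfolding f using assms(2) by simp
  }
qed

lemma between_avoiding_finite:
  fixes a b :: real
  assumes "a < b" "finite S"
  obtains x where "a < x" "x < b" "x \<notin> S"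
proof -
  have "infinite ({a<..<b} - S)"
    using assms by (intro Diff_infinite_finite infinite_Ioo)
  then obtain x where "x \<in> {a<..<b} - S"
    by (metis equals0I finite.emptyI)
  then show ?thesis using that by auto
qed

text \<open>Any violated inequality between two entries leaves an open interval between them, and at
  a point of it the two counts differ by a forbidden amount. S collects the points at which the
  counts are not controlled.\<close>

lemma chain_interlace_if_counts:
  fixes xs ys :: "real list"
  assumes s: "sorted xs" "sorted ys" and S: "finite S"
    and cnt: "\<And>x. x \<notin> S \<Longrightarrow> length (filter (\<lambda>t. x < t) ys) = length (filter (\<lambda>t. x < t) xs) \<or>
        length (filter (\<lambda>t. x < t) ys) = Suc (length (filter (\<lambda>t. x < t) xs))"
  shows "chain_interlace xs ys \<or> chain_interlace ys xs"
proof -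
  let ?c = "\<lambda>x zs. length (filter (\<lambda>t. x < t) zs)"
  note L = sorted_filter_greater_length[OF s(1)] and R = sorted_filter_greater_length[OF s(2)]
  \<comment> \<open>To the left of all entries the counts are the lengths. The inserted 0 keeps
    \<open>Min\<close> meaningful for empty lists.\<close>
  define m where "m = Min (insert 0 (set xs \<union> set ys))"
  obtain x0 where x0: "x0 < m" "x0 \<notin> S"
    using between_avoiding_finite[OF _ S, of "m - 1" m] by auto
  have "x0 < t" if "t \<in> set xs \<union> set ys" for t
  proof -
    have "m \<le> t" unfolding m_def using that by (intro Min_le) auto
    then show ?thesis using x0 by simp
  qed
  then have "?c x0 xs = length xs" "?c x0 ys = length ys"
    by (simp_all add: filter_id_conv[THEN iffD2])
  then consider "length ys = length xs" | "length ys = Suc (length xs)"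
    using cnt[OF x0(2)] by metis
  then show ?thesis
  proof cases
    case 1
    have "xs ! i \<le> ys ! i" if "i < length xs" for i
    proof (rule ccontr)
      assume "\<not> xs ! i \<le> ys ! i"
      then have lt: "ys ! i < xs ! i" by simp
      obtain x where x: "ys ! i < x" "x < xs ! i" "x \<notin> S"
        using between_avoiding_finite[OF lt S] .
      then show False using L(1)[of i x] R(2)[of i x] that 1 cnt[OF x(3)] by auto
    qed
    moreover have "ys ! i \<le> xs ! Suc i" if "Suc i < length xs" for i
    proof (rule ccontr)
      assume "\<not> ys ! i \<le> xs ! Suc i"
      then have lt: "xs ! Suc i < ys ! i" by simp
      obtain x where x: "xs ! Suc i < x" "x < ys ! i" "x \<notin> S"
        using between_avoiding_finite[OF lt S] .
      then show False using L(2)[of "Suc i" x] R(1)[of i x] that 1 cnt[OF x(3)] by auto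
    qed
    ultimately show ?thesis using 1 by (simp add: chain_interlace_def)
  next
    case 2
    have "ys ! i \<le> xs ! i" if "i < length xs" for i
    proof (rule ccontr)
      assume "\<not> ys ! i \<le> xs ! i"
      then have lt: "xs ! i < ys ! i" by simp
      obtain x where x: "xs ! i < x" "x < ys ! i" "x \<notin> S"
        using between_avoiding_finite[OF lt S] .
      then show False using L(2)[of i x] R(1)[of i x] that 2 cnt[OF x(3)] by auto
    qed
    moreover have "xs ! i \<le> ys ! Suc i" if "i < length xs" for i
    proof (rule ccontr)
      assume "\<not> xs ! i \<le> ys ! Suc i"
      then have lt: "ys ! Suc i < xs ! i" by simp
      obtain x where x: "ys ! Suc i < x" "x < xs ! i" "x \<notin> S"
        using between_avoiding_finite[OF lt S] .
      then show False using L(1)[of i x] R(2)[of "Suc i" x] that 2 cnt[OF x(3)] by auto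
    qed
    ultimately show ?thesis using 2 by (simp add: chain_interlace_def)
  qed
qed

lemma connected_upper_half_plane: "connected {z. Im z > 0}"
  by (intro convex_connected convex_halfspace_Im_gt)

text \<open>The angle difference \<Phi> avoids all multiples of \<pi> and is continuous on a
  connected set, so it stays in one gap. Its limits at real points are the multiples
  \<open>D x\<close> of \<pi>, with \<open>D x\<close> the difference of the numbers of zeros beyond
  x; hence D takes at most two values, and these are consecutive.\<close>

lemma interlace_if_no_real_ratio:
  assumes P: "P \<in> H1R" and Q: "Q \<in> H1R"
    and nr: "\<And>z. Im z > 0 \<Longrightarrow> Im (cnj (poly P z) * poly Q z) \<noteq> 0"
  shows "zeros_interlace P Q"
proof -
  have rP: "real_poly P" and rQ: "real_poly Q" using P Q by (auto simp: H1R_def)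
  define xs where "xs = real_zeros P"
  define ys where "ys = real_zeros Q"
  define p where "p = Re (lead_coeff P)"
  define q where "q = Re (lead_coeff Q)"
  have Pe: "P = smult (of_real p) (root_poly xs)"
    using real_zerosD(2)[OF P] real_poly_lead_coeff[OF rP] by (simp add: p_def xs_def)
  have Qe: "Q = smult (of_real q) (root_poly ys)"
    using real_zerosD(2)[OF Q] real_poly_lead_coeff[OF rQ] by (simp add: q_def ys_def)
  define \<Phi> where "\<Phi> z = root_angle ys z - root_angle xs z" for z
  have sin: "sin (\<Phi> z) \<noteq> 0" if z: "Im z > 0" for z
  proof -
    obtain r where r: "r > 0" "poly (root_poly xs) z = of_real r * cis (root_angle xs z)"
      using root_poly_polar[OF z] .
    obtain s where s: "s > 0" "poly (root_poly ys) z = of_real s * cis (root_angle ys z)"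
      using root_poly_polar[OF z] .
    have "cnj (poly P z) * poly Q z = of_real (p * r * q * s) * cis (\<Phi> z)"
      by (subst Pe, subst Qe) (simp add: r s \<Phi>_def cis_cnj cis_mult mult_ac)
    then have "Im (cnj (poly P z) * poly Q z) = p * r * q * s * sin (\<Phi> z)" by simp
    then show ?thesis using nr[OF z] by auto
  qed
  have cont: "continuous_on {z. Im z > 0} \<Phi>"
  proof -
    have "continuous_on {z. Im z > 0} (\<lambda>z. upper_arg (z - of_real x))" for x
      by (rule continuous_on_compose2[OF continuous_on_upper_arg]) (auto intro!: continuous_intros)
    then show ?thesis
      unfolding \<Phi>_def root_angle_eq_sum by (intro continuous_intros)
  qed
  have no_cross: False if "Im z1 > 0" "Im z2 > 0" "\<Phi> z1 < of_int k * pi" "of_int k * pi < \<Phi> z2" for z1 z2 k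
  proof -
    have "connected (\<Phi> ` {z. Im z > 0})"
      by (rule connected_continuous_image[OF cont connected_upper_half_plane])
    then have "{\<Phi> z1..\<Phi> z2} \<subseteq> \<Phi> ` {z. Im z > 0}"
      using that(1,2) by (intro connected_contains_Icc) blast+
    then have "of_int k * pi \<in> \<Phi> ` {z. Im z > 0}"
      using that(3,4) by (meson atLeastAtMost_iff less_imp_le subsetD)
    then obtain z where "Im z > 0" "\<Phi> z = of_int k * pi" by auto
    moreover from this have "sin (\<Phi> z) = 0"
      unfolding sin_zero_iff_int2 by blast
    ultimately show False using sin[of z] by simp
  qed
  define S where "S = set xs \<union> set ys"
  define D where "D x = int (length (filter (\<lambda>t. x < t) ys)) - int (length (filter (\<lambda>t. x < t) xs))" for x
  have lim: "((\<lambda>\<epsilon>. \<Phi> (Complex x \<epsilon>)) \<longlongrightarrow> of_int (D x) * pi) (at_right 0)" if "x \<notin> S" for x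
  proof -
    have "((\<lambda>\<epsilon>. \<Phi> (Complex x \<epsilon>)) \<longlongrightarrow> pi * real (length (filter (\<lambda>t. x < t) ys))
        - pi * real (length (filter (\<lambda>t. x < t) xs))) (at_right 0)"
      unfolding \<Phi>_def using that by (intro tendsto_diff root_angle_boundary) (auto simp: S_def)
    then show ?thesis by (simp add: D_def algebra_simps)
  qed
  have below: "\<exists>z. Im z > 0 \<and> \<Phi> z < of_int k * pi" if "x \<notin> S" "D x < k" for x k
  proof -
    have "of_int (D x) * pi < of_int k * pi" using that by simp
    from order_tendstoD(2)[OF lim[OF that(1)] this]
    have "eventually (\<lambda>\<epsilon>. \<epsilon> > 0 \<and> \<Phi> (Complex x \<epsilon>) < of_int k * pi) (at_right 0)"
      using eventually_at_right_less by (rule eventually_conj[rotated])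
    then obtain \<epsilon> :: real where "\<epsilon> > 0" "\<Phi> (Complex x \<epsilon>) < of_int k * pi"
      using eventually_happens' by (metis (mono_tags, lifting) trivial_limit_at_right_real)
    then show ?thesis by (intro exI[of _ "Complex x \<epsilon>"]) simp
  qed
  have above: "\<exists>z. Im z > 0 \<and> of_int k * pi < \<Phi> z" if "x \<notin> S" "k < D x" for x k
  proof -
    have "of_int k * pi < of_int (D x) * pi" using that by simp
    from order_tendstoD(1)[OF lim[OF that(1)] this]
    have "eventually (\<lambda>\<epsilon>. \<epsilon> > 0 \<and> of_int k * pi < \<Phi> (Complex x \<epsilon>)) (at_right 0)"
      using eventually_at_right_less by (rule eventually_conj[rotated])
    then obtain \<epsilon> :: real where "\<epsilon> > 0" "of_int k * pi < \<Phi> (Complex x \<epsilon>)"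
      using eventually_happens' by (metis (mono_tags, lifting) trivial_limit_at_right_real)
    then show ?thesis by (intro exI[of _ "Complex x \<epsilon>"]) simp
  qed
  have gap: False if "x \<notin> S" "y \<notin> S" "D x < k" "k < D y" for x y k
    using below[of x k] above[of y k] no_cross that by blast
  have fS: "finite S" by (simp add: S_def)
  \<comment> \<open>To the right of all zeros both counts are 0. This fixes the two possible values
    of D as 0, 1 or 0, -1.\<close>
  define M where "M = Max (insert 0 S) + 1"
  have MS: "t < M" if "t \<in> S" for t
  proof -
    have "t \<le> Max (insert 0 S)" using that fS by (intro Max_ge) auto
    then show ?thesis unfolding M_def by linarith
  qed
  have "M \<notin> S" using MS[of M] by auto
  have "filter (\<lambda>t. M < t) xs = []" "filter (\<lambda>t. M < t) ys = []"
    using MS by (force simp: filter_empty_conv S_def not_less)+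
  then have DM: "D M = 0" by (simp only: D_def list.size of_nat_0 diff_self)
  have *: "(\<forall>x. x \<notin> S \<longrightarrow> D x = 0 \<or> D x = 1) \<or> (\<forall>x. x \<notin> S \<longrightarrow> D x = 0 \<or> D x = - 1)"
  proof (cases "\<exists>x. x \<notin> S \<and> D x \<ge> 1")
    case True
    then obtain x0 where x0: "x0 \<notin> S" "D x0 \<ge> 1" by blast
    have "D x = 0 \<or> D x = 1" if "x \<notin> S" for x
      using gap[of x x0 0] gap[of M x 1] x0 that \<open>M \<notin> S\<close> DM by force
    then show ?thesis by blast
  next
    case False
    have "D x = 0 \<or> D x = - 1" if "x \<notin> S" for x
      using gap[of x M "-1"] False that \<open>M \<notin> S\<close> DM by force
    then show ?thesis by blast
  qed
  have srt: "sorted xs" "sorted ys"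
    unfolding xs_def ys_def using real_zerosD(1) P Q by blast+
  have "chain_interlace xs ys \<or> chain_interlace ys xs"
    using *
  proof
    assume D: "\<forall>x. x \<notin> S \<longrightarrow> D x = 0 \<or> D x = 1"
    show ?thesis
    proof (rule chain_interlace_if_counts[OF srt fS])
      fix x assume "x \<notin> S"
      with D have "D x = 0 \<or> D x = 1" by blast
      then show "length (filter (\<lambda>t. x < t) ys) = length (filter (\<lambda>t. x < t) xs) \<or>
          length (filter (\<lambda>t. x < t) ys) = Suc (length (filter (\<lambda>t. x < t) xs))"
        unfolding D_def by linarith
    qed
  next
    assume D: "\<forall>x. x \<notin> S \<longrightarrow> D x = 0 \<or> D x = - 1"
    have "chain_interlace ys xs \<or> chain_interlace xs ys"
    proof (rule chain_interlace_if_counts[OF srt(2,1) fS])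
      fix x assume "x \<notin> S"
      with D have "D x = 0 \<or> D x = - 1" by blast
      then show "length (filter (\<lambda>t. x < t) xs) = length (filter (\<lambda>t. x < t) ys) \<or>
          length (filter (\<lambda>t. x < t) xs) = Suc (length (filter (\<lambda>t. x < t) ys))"
        unfolding D_def by linarith
    qed
    then show ?thesis by blast
  qed
  then show ?thesis by (auto simp: zeros_interlace_def xs_def ys_def)
qed

section \<open>The symbol as a bivariate polynomial\<close>

text \<open>z + c w, so that the symbols in (c) and (d) are treated together, with c = 1 and c =
  -1.\<close>

definition symbol_base :: "complex \<Rightarrow> complex poly poly" where
  "symbol_base c = [: [:0, 1:], [:c:] :]"

lemma symbol_base_plus: "symbol_base 1 = z_plus_w"
  and symbol_base_minus: "symbol_base (- 1) = z_minus_w"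
  by (simp_all add: symbol_base_def z_plus_w_def z_minus_w_def one_pCons)

lemma coeff_symbol_base_power:
  assumes "l \<le> n"
  shows "coeff (symbol_base c ^ n) l = smult (of_nat (n choose l) * c ^ l) ([:0, 1:] ^ (n - l))"
  unfolding symbol_base_def coeff_linear_poly_power[OF assms]
  by (simp add: of_nat_poly poly_const_pow mult.commute)

lemma degree_symbol_base_power: "c \<noteq> 0 \<Longrightarrow> degree (symbol_base c ^ n) = n"
  by (simp add: symbol_base_def degree_power_eq)

lemma coeff_extT: "coeff (extT T F) l = (if l \<le> degree F then T (coeff F l) else 0)"
  by (simp add: extT_def coeff_sum)

lemma degree_extT_le: "degree (extT T F) \<le> degree F"
  by (rule degree_le) (simp add: coeff_extT)

lemma eval2_eq_sum:
  assumes "degree F \<le> n"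
  shows "eval2 F z w = (\<Sum>l\<le>n. poly (coeff F l) z * w ^ l)"
proof -
  define G where "G = map_poly (\<lambda>c. poly c z) F"
  have cG: "coeff G l = poly (coeff F l) z" for l
    by (simp add: G_def coeff_map_poly)
  have "degree G \<le> n"
    using assms by (auto simp: cG coeff_eq_0 intro: degree_le)
  then have "G = (\<Sum>l\<le>n. monom (coeff G l) l)"
    using poly_as_sum_of_monoms' by metis
  then have "poly G w = (\<Sum>l\<le>n. coeff G l * w ^ l)"
    by (metis (no_types, lifting) poly_monom poly_sum sum.cong)
  then show ?thesis by (simp add: eval2_def G_def[symmetric] cG)
qed

text \<open>T acts on z only, so w may be fixed before T is applied. Bivariate stability thereby
  becomes a statement about T on univariate powers.\<close>

lemma eval2_symbol:
  assumes T: "lin_op_on n T" and c: "c \<noteq> 0"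
  shows "eval2 (smult [:\<eta>:] (extT T (symbol_base c ^ n))) z w = \<eta> * poly (T ([:c * w, 1:] ^ n)) z"
proof -
  have deg: "degree (smult [:\<eta>:] (extT T (symbol_base c ^ n))) \<le> n"
    using degree_extT_le[of T "symbol_base c ^ n"] degree_symbol_base_power[OF c, of n]
    by (intro order_trans[OF degree_smult_le]) simp
  have mon: "degree ([:0, 1:] ^ (n - l) :: complex poly) \<le> n" for l
    by (simp add: degree_power_eq)
  have "T ([:c * w, 1:] ^ n) = (\<Sum>l\<le>n. smult (of_nat (n choose l) * (c * w) ^ l) (T ([:0, 1:] ^ (n - l))))"
    by (subst linear_power_expansion) (rule lin_op_on_sum[OF T _ mon], simp)
  moreover have "coeff (extT T (symbol_base c ^ n)) l = smult (of_nat (n choose l) * c ^ l) (T ([:0, 1:] ^ (n - l)))"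
    if "l \<in> {..n}" for l
    using that mon[of l] by (simp add: coeff_extT degree_symbol_base_power[OF c] coeff_symbol_base_power lin_op_on_smult[OF T])
  ultimately show ?thesis
    unfolding eval2_eq_sum[OF deg]
    by (simp add: poly_sum sum_distrib_left power_mult_distrib mult_ac)
qed

lemma lin_op_on_real_poly:
  assumes T: "lin_op_on n T" and mon: "\<And>k. k \<le> n \<Longrightarrow> real_poly (T (monom 1 k))"
    and h: "degree h \<le> n" "real_poly h"
  shows "real_poly (T h)"
  unfolding lin_op_on_monoms[OF T h(1)]
  using mon h(2) by (intro real_poly_sum real_poly_smult) (auto simp: real_poly_def)

lemma real_poly_minus: "real_poly p \<Longrightarrow> real_poly (- p)"
  using real_poly_smult[of "- 1" p] by simp

text \<open>The coefficient of w^l is \<eta> T(z^(n - l)) times a non-zero real number, so the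
  symbol has real coefficients precisely when \<eta> T maps real polynomials to real ones.\<close>

lemma symbol_H2R_iff:
  assumes T: "lin_op_on n T" and c: "c \<in> \<real>" "c \<noteq> 0"
  shows "smult [:\<eta>:] (extT T (symbol_base c ^ n)) \<in> H2R \<longleftrightarrow>
    (\<forall>h. degree h \<le> n \<longrightarrow> real_poly h \<longrightarrow> real_poly (smult \<eta> (T h))) \<and>
    (\<forall>z w. Im z > 0 \<longrightarrow> Im w > 0 \<longrightarrow> \<eta> * poly (T ([:c * w, 1:] ^ n)) z \<noteq> 0)"
    (is "?F \<in> H2R \<longleftrightarrow> ?real \<and> ?nz")
proof -
  have cf: "coeff ?F l = (if l \<le> n then smult (of_nat (n choose l) * c ^ l) (smult \<eta> (T (monom 1 (n - l)))) else 0)" for l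
  proof (cases "l \<le> n")
    case True
    have "degree (monom (1::complex) (n - l)) \<le> n" by (simp add: degree_monom_eq)
    then show ?thesis using True
      by (simp add: coeff_extT degree_symbol_base_power[OF c(2)] coeff_symbol_base_power
          lin_op_on_smult[OF T] monom_altdef mult_ac)
  qed (simp add: coeff_extT degree_symbol_base_power[OF c(2)])
  have T': "lin_op_on n (\<lambda>f. smult \<eta> (T f))"
    using T by (simp add: lin_op_on_def smult_add_right mult.commute)
  have "(\<forall>l k. coeff (coeff ?F l) k \<in> \<real>) \<longleftrightarrow> ?real"
  proof
    assume r: "\<forall>l k. coeff (coeff ?F l) k \<in> \<real>"
    have "real_poly (smult \<eta> (T (monom 1 k)))" if k: "k \<le> n" for k
    proof -
      define e where "e = of_nat (n choose (n - k)) * c ^ (n - k)"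
      have e: "e \<in> \<real>" "e \<noteq> 0" using c k by (auto simp: e_def binomial_eq_0_iff)
      have "coeff ?F (n - k) = smult e (smult \<eta> (T (monom 1 k)))"
        using cf[of "n - k"] k by (simp add: e_def)
      moreover have "real_poly (coeff ?F (n - k))"
        unfolding real_poly_def using r by blast
      ultimately have "real_poly (smult e (smult \<eta> (T (monom 1 k))))"
        by (simp only:)
      then have "real_poly (smult (inverse e) (smult e (smult \<eta> (T (monom 1 k)))))"
        by (rule real_poly_smult[OF Reals_inverse[OF e(1)]])
      moreover have "inverse e * (e * \<eta>) = \<eta>" using e(2) by simp
      ultimately show ?thesis by (simp only: smult_smult)
    qed
    then show ?real using lin_op_on_real_poly[OF T'] by blast
  next
    assume r: ?real
    have "real_poly (coeff ?F l)" for l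
    proof (cases "l \<le> n")
      case True
      have "real_poly (smult \<eta> (T (monom 1 (n - l))))"
        using r by (simp add: degree_monom_eq)
      then show ?thesis
        unfolding cf if_P[OF True] by (rule real_poly_smult[rotated]) (use c in auto)
    next
      case False
      then show ?thesis unfolding cf by simp
    qed
    then show "\<forall>l k. coeff (coeff ?F l) k \<in> \<real>" by (simp add: real_poly_def)
  qed
  moreover have "?F \<noteq> 0" if ?nz
  proof
    assume "?F = 0"
    then have "eval2 ?F \<i> \<i> = 0" by (simp only:) (simp add: eval2_def)
    moreover have "\<eta> * poly (T ([:c * \<i>, 1:] ^ n)) \<i> \<noteq> 0"
      by (rule that[rule_format]) simp_all
    ultimately show False by (simp only: eval2_symbol[OF T c(2)])
  qed
  ultimately show ?thesis
    unfolding H2R_def by (auto simp: eval2_symbol[OF T c(2)])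
qed

lemma symbol_H2R_preserves_real_rooted_plus:
  assumes T: "lin_op_on n T" and F: "smult [:\<eta>:] (extT T (z_plus_w ^ n)) \<in> H2R"
    and f: "f \<in> pi_n_set n \<real>"
  shows "T f \<in> pi_set \<real> \<union> {0}"
proof -
  define S where "S f = smult \<eta> (T f)" for f
  have S: "lin_op_on n S"
    using T by (simp add: S_def lin_op_on_def smult_add_right mult.commute)
  have H: "(\<forall>h. degree h \<le> n \<longrightarrow> real_poly h \<longrightarrow> real_poly (S h)) \<and>
    (\<forall>z w. Im z > 0 \<longrightarrow> Im w > 0 \<longrightarrow> poly (S ([:w, 1:] ^ n)) z \<noteq> 0)"
    using F symbol_H2R_iff[OF T, of 1] by (simp add: symbol_base_plus S_def)
  \<comment> \<open>Nonvanishing at one point excludes \<eta> = 0, so \<eta> can be cancelled at the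
    end.\<close>
  then have "poly (S ([:\<i>, 1:] ^ n)) \<i> \<noteq> 0" by simp
  then have \<eta>: "\<eta> \<noteq> 0" by (auto simp: S_def)
  have "S f = 0" if "poly (S f) z = 0" "z \<notin> \<real>" for z
    using stable_symbol_preserves_real_rooted[OF S _ _ _ _ that] H f
    by (auto simp: pi_n_set_def pi_set_def)
  then show ?thesis using \<eta> by (auto simp: S_def pi_set_def)
qed

lemma symbol_H2R_preserves_real_rooted_minus:
  assumes T: "lin_op_on n T" and F: "smult [:\<eta>:] (extT T (z_minus_w ^ n)) \<in> H2R"
    and f: "f \<in> pi_n_set n \<real>"
  shows "T f \<in> pi_set \<real> \<union> {0}"
proof -
  \<comment> \<open>The reflection z \<mapsto> -z is an involution that keeps degree, reality and
    real-rootedness, and it sends (z + w)^n to (z - w)^n up to sign. Hence T composed with R falls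
    under the plus case.\<close>
  define R where "R f = pcompose f [:0, - 1 :: complex:]" for f
  have dR: "degree (R f) = degree f" for f by (simp add: R_def degree_pcompose)
  have RR: "R (R f) = f" for f
    unfolding R_def pcompose_assoc[symmetric] by (simp add: pcompose_pCons pcompose_idR)
  have realR: "real_poly (R f)" if "real_poly f" for f
    using that by (induction f) (auto simp: R_def pcompose_pCons intro!: real_poly_add real_poly_minus)
  have R_add: "R (f + g) = R f + R g" and R_smult: "R (smult c f) = smult c (R f)" for f g c
    by (simp_all add: R_def pcompose_add pcompose_smult)
  define S where "S f = T (R f)" for f
  have S: "lin_op_on n S"
    using T by (simp add: S_def lin_op_on_def Cn_def dR R_add R_smult)
  have H: "(\<forall>h. degree h \<le> n \<longrightarrow> real_poly h \<longrightarrow> real_poly (smult \<eta> (T h))) \<and>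
    (\<forall>z w. Im z > 0 \<longrightarrow> Im w > 0 \<longrightarrow> \<eta> * poly (T ([:- w, 1:] ^ n)) z \<noteq> 0)"
    using F symbol_H2R_iff[OF T, of "- 1"] by (simp add: symbol_base_minus)
  have RP: "R ([:w, 1:] ^ n) = smult ((- 1) ^ n) ([:- w, 1:] ^ n)" for w
  proof -
    have "R ([:w, 1:] ^ n) = [:w, - 1:] ^ n"
      unfolding R_def
      by (induction n) (simp_all only: power_0 power_Suc pcompose_mult pcompose_1, simp add: pcompose_pCons)
    also have "[:w, - 1:] = smult (- 1) [:- w, 1:]" by simp
    finally show ?thesis by (simp only: smult_power)
  qed
  have SP: "S ([:w, 1:] ^ n) = smult ((- 1) ^ n) (T ([:- w, 1:] ^ n))" for w
    unfolding S_def RP by (rule lin_op_on_smult[OF T]) (simp add: degree_power_eq)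
  have "smult [:\<eta>:] (extT S (symbol_base 1 ^ n)) \<in> H2R"
    unfolding symbol_H2R_iff[OF S Reals_1 one_neq_zero]
    using H realR by (auto simp: SP) (auto simp: S_def dR)
  then have pl: "smult [:\<eta>:] (extT S (z_plus_w ^ n)) \<in> H2R"
    by (simp add: symbol_base_plus)
  have "R f \<in> pi_n_set n \<real>"
  proof -
    have "- u \<in> \<real>" if "poly (R f) u = 0" for u
      using f that by (auto simp: R_def poly_pcompose pi_n_set_def pi_set_def)
    then have "u \<in> \<real>" if "poly (R f) u = 0" for u
      using that by force
    moreover have "R f \<noteq> 0"
      using RR[of f] f by (auto simp: R_def pi_n_set_def pi_set_def)
    ultimately show ?thesis
      using f by (auto simp: pi_n_set_def pi_set_def dR)
  qed
  from symbol_H2R_preserves_real_rooted_plus[OF S pl this]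
  show ?thesis by (simp add: S_def RR)
qed

section \<open>A pencil that stays real-rooted under perturbation\<close>

lemma real_poly_Im: "real_poly h \<Longrightarrow> Im (poly h (of_real t)) = 0"
  using poly_real_cnj[of h "of_real t"] by (simp add: complex_eq_iff)

text \<open>The sign changes produce n - 1 distinct real zeros. A non-real zero would bring its
  conjugate along, giving n + 1 zeros in degree at most n.\<close>

lemma real_rooted_if_alternating:
  fixes x :: "nat \<Rightarrow> real" and s :: real
  assumes h: "real_poly h" "degree h \<le> n" and n: "n > 0"
    and dec: "\<And>i j. i < j \<Longrightarrow> j < n \<Longrightarrow> x j < x i"
    and alt: "\<And>k. k < n \<Longrightarrow> (- 1) ^ k * s * Re (poly h (of_real (x k))) > 0"
  shows "h \<in> pi_n_set n \<real>"
proof -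
  define H where "H t = Re (poly h (of_real t))" for t :: real
  have hH: "poly h (of_real t) = of_real (H t)" for t
    using real_poly_Im[OF h(1), of t] by (simp add: H_def complex_eq_iff)
  have cont: "continuous_on A H" for A
    unfolding H_def by (intro continuous_intros)
  have h0: "h \<noteq> 0" using alt[OF n] by auto
  have "\<exists>r. x (Suc k) < r \<and> r < x k \<and> H r = 0" if k: "k < n - 1" for k
  proof -
    have p: "(- 1) ^ k * s * H (x k) > 0" "- ((- 1) ^ k * s * H (x (Suc k))) > 0"
      using alt[of k] alt[of "Suc k"] k by (auto simp: H_def)
    then have ne: "(- 1) ^ k * s \<noteq> 0" by auto
    have "continuous_on {x (Suc k)..x k} (\<lambda>t. (- 1) ^ k * s * H t)"
      by (intro continuous_intros cont)
    then obtain r where r: "x (Suc k) \<le> r" "r \<le> x k" "(- 1) ^ k * s * H r = 0"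
      using IVT'[of "\<lambda>t. (- 1) ^ k * s * H t" "x (Suc k)" 0 "x k"] p dec[of k "Suc k"] k by fastforce
    then have "r \<noteq> x (Suc k)" "r \<noteq> x k" using p by auto
    then show ?thesis using r ne by (intro exI[of _ r]) auto
  qed
  then obtain r where r: "\<And>k. k < n - 1 \<Longrightarrow> x (Suc k) < r k \<and> r k < x k \<and> H (r k) = 0"
    by metis
  have rdec: "r j < r i" if "i < j" "j < n - 1" for i j
  proof -
    have "j < n" "i < n - 1" using that by linarith+
    then have "x j \<le> x (Suc i)" using dec[of "Suc i" j] that by (cases "j = Suc i") auto
    then show ?thesis using r[of i] r[of j] that \<open>i < n - 1\<close> by auto
  qed
  then have inj: "inj_on r {..<n - 1}"
    by (intro linorder_inj_onI) (auto, metis less_irrefl)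
  have "u \<in> \<real>" if u: "poly h u = 0" for u
  proof (rule ccontr)
    assume nr: "u \<notin> \<real>"
    define Z where "Z = (\<lambda>k. complex_of_real (r k)) ` {..<n - 1}"
    have "card Z = n - 1"
      unfolding Z_def using inj by (subst card_image) (auto simp: inj_on_def)
    moreover have "u \<notin> Z" "cnj u \<notin> Z" "u \<noteq> cnj u"
      using nr by (auto simp: Z_def complex_is_Real_iff complex_eq_iff)
    moreover have "finite Z" by (simp add: Z_def)
    ultimately have "card (insert u (insert (cnj u) Z)) = n + 1"
      using n by simp
    moreover have "insert u (insert (cnj u) Z) \<subseteq> {z. poly h z = 0}"
      using u r by (auto simp: Z_def hH poly_real_cnj[OF h(1)])
    ultimately have "n + 1 \<le> card {z. poly h z = 0}"
      using card_mono[OF poly_roots_finite[OF h0]] by metis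
    then show False using card_poly_roots_bound[OF h0] h(2) by simp
  qed
  then show ?thesis using h0 h(2) by (auto simp: pi_n_set_def pi_set_def)
qed

text \<open>As c varies, this is the real plane spanned by the coefficientwise real and imaginary
  parts of (z + w)^n.\<close>

definition pencil :: "nat \<Rightarrow> complex \<Rightarrow> complex \<Rightarrow> complex poly" where
  "pencil n c w = smult c ([:w, 1:] ^ n) + smult (cnj c) ([:cnj w, 1:] ^ n)"

lemma degree_pencil: "degree (pencil n c w) \<le> n"
  unfolding pencil_def
  by (intro degree_add_le order_trans[OF degree_smult_le]) (simp_all add: degree_power_eq)

lemma poly_pencil_real: "poly (pencil n c w) (of_real t) = of_real (2 * Re (c * (of_real t + w) ^ n))"
proof -
  have "poly (pencil n c w) (of_real t) = c * (of_real t + w) ^ n + cnj (c * (of_real t + w) ^ n)"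
    by (simp add: pencil_def poly_power add.commute)
  then show ?thesis by (simp only: complex_add_cnj)
qed

lemma real_poly_pencil: "real_poly (pencil n c w)"
proof -
  have "coeff (pencil n c w) i \<in> \<real>" for i
  proof (cases "i \<le> n")
    case True
    have "coeff (pencil n c w) i =
        of_nat (n choose i) * (c * w ^ (n - i) + cnj (c * w ^ (n - i)))"
      by (simp add: pencil_def coeff_linear_poly_power[OF True] algebra_simps)
    then show ?thesis by (simp only: complex_add_cnj) auto
  next
    case False
    then show ?thesis
      using degree_pencil[of n c w] by (simp add: coeff_eq_0)
  qed
  then show ?thesis by (simp add: real_poly_def)
qed

text \<open>The argument of \<open>(x + w) ^ n\<close> decreases by \<open>n \<pi>\<close> as \<open>x\<close> runs over the real line, so its real part
  alternates in sign at \<open>n\<close> points, wherever the first one is placed.\<close>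

lemma pencil_alternates:
  assumes w: "Im w > 0" and c: "c \<noteq> 0" and n: "n > 0"
  shows "\<exists>(x :: nat \<Rightarrow> real) (s :: real). (\<forall>i j. i < j \<longrightarrow> j < n \<longrightarrow> x j < x i) \<and>
    (\<forall>k<n. (- 1) ^ k * s * Re (poly (pencil n c w) (of_real (x k))) > 0)"
proof -
  \<comment> \<open>\<phi> only has to make s non-zero: \<pi>/2 gives s = - Im c, and when that
    vanishes, \<pi>/4 gives a non-zero multiple of Re c.\<close>
  define \<phi> where "\<phi> = (if Im c = 0 then pi / 4 else pi / 2)"
  define s where "s = Re (c * cis \<phi>)"
  have \<phi>: "0 < \<phi>" "\<phi> < pi" by (auto simp: \<phi>_def)
  have s: "s \<noteq> 0"
    using c by (auto simp: s_def \<phi>_def complex_eq_iff cos_45 sin_45)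
  define \<theta> where "\<theta> k = (\<phi> + real k * pi) / real n" for k
  have \<theta>: "0 < \<theta> k" "\<theta> k < pi" if "k < n" for k
  proof -
    show "0 < \<theta> k" using \<phi> n by (simp add: \<theta>_def add_pos_nonneg)
    have "\<phi> + real k * pi < pi + real k * pi" using \<phi> by simp
    also have "\<dots> = real (Suc k) * pi" by (simp add: algebra_simps)
    also have "\<dots> \<le> real n * pi" using that by (intro mult_right_mono) auto
    finally show "\<theta> k < pi" using n by (simp add: \<theta>_def field_simps)
  qed
  have sp: "sin (\<theta> k) > 0" if "k < n" for k using \<theta>[OF that] by (rule sin_gt_zero)
  \<comment> \<open>The real point at which x + w has argument \<theta> k; then (x + w)^n has
    argument \<phi> + k\<pi>.\<close>
  define x where "x k = Im w * cos (\<theta> k) / sin (\<theta> k) - Re w" for k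
  have xw: "of_real (x k) + w = of_real (Im w / sin (\<theta> k)) * cis (\<theta> k)" if "k < n" for k
    using sp[OF that] by (simp add: complex_eq_iff x_def)
  show ?thesis
  proof (intro exI conjI allI impI)
    fix i j :: nat assume ij: "i < j" "j < n"
    have "\<theta> i < \<theta> j" using ij n by (simp add: \<theta>_def divide_strict_right_mono)
    then have "sin (\<theta> j - \<theta> i) > 0"
      using \<theta>[of i] \<theta>[of j] ij by (intro sin_gt_zero) auto
    then have "cos (\<theta> j) / sin (\<theta> j) < cos (\<theta> i) / sin (\<theta> i)"
      using sp[of i] sp[of j] ij by (simp add: sin_diff field_simps)
    then have "Im w * (cos (\<theta> j) / sin (\<theta> j)) < Im w * (cos (\<theta> i) / sin (\<theta> i))"
      using w by (rule mult_strict_left_mono)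
    then show "x j < x i" by (simp add: x_def)
  next
    fix k assume k: "k < n"
    define \<rho> where "\<rho> = (Im w / sin (\<theta> k)) ^ n"
    have \<rho>: "\<rho> > 0" using sp[OF k] w by (simp add: \<rho>_def)
    have "real n * \<theta> k = \<phi> + real k * pi" using n by (simp add: \<theta>_def)
    then have "cis (\<theta> k) ^ n = cis \<phi> * cis (real k * pi)"
      by (metis Complex.DeMoivre cis_mult)
    also have "cis (real k * pi) = (- 1) ^ k"
      by (metis Complex.DeMoivre cis_pi)
    finally have "cis (\<theta> k) ^ n = cis \<phi> * (- 1) ^ k" .
    then have "(of_real (x k) + w) ^ n = of_real (\<rho> * (- 1) ^ k) * cis \<phi>"
      by (simp add: xw[OF k] power_mult_distrib \<rho>_def power_divide)
    then have "c * (of_real (x k) + w) ^ n = of_real (\<rho> * (- 1) ^ k) * (c * cis \<phi>)"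
      by (simp only: mult_ac)
    then have "Re (c * (of_real (x k) + w) ^ n) = \<rho> * (- 1) ^ k * s"
      by (simp only: s_def Re_complex_of_real Im_complex_of_real times_complex.sel)
    then have "(- 1) ^ k * s * Re (poly (pencil n c w) (of_real (x k))) = 2 * \<rho> * s\<^sup>2 * ((- 1) ^ k * (- 1) ^ k)"
      by (simp add: poly_pencil_real power2_eq_square)
    also have "\<dots> = 2 * \<rho> * s\<^sup>2" by (simp flip: power_mult_distrib)
    finally show "(- 1) ^ k * s * Re (poly (pencil n c w) (of_real (x k))) > 0"
      using \<rho> s by simp
  qed
qed

text \<open>Strict alternation at finitely many fixed points is an open condition, and it does not
  see whether h changes the degree.\<close>

lemma pencil_perturb:
  assumes w: "Im w > 0" and c: "c \<noteq> 0" and n: "n > 0"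
    and h: "real_poly h" "degree h \<le> n"
  shows "\<forall>\<^sub>F \<epsilon> :: real in nhds 0. pencil n c w + smult (of_real \<epsilon>) h \<in> pi_n_set n \<real>"
proof -
  obtain x :: "nat \<Rightarrow> real" and s :: real where dec: "\<And>i j. i < j \<Longrightarrow> j < n \<Longrightarrow> x j < x i"
    and alt: "\<And>k. k < n \<Longrightarrow> (- 1) ^ k * s * Re (poly (pencil n c w) (of_real (x k))) > 0"
    using pencil_alternates[OF w c n] by blast
  define F where "F \<epsilon> = pencil n c w + smult (of_real \<epsilon>) h" for \<epsilon> :: real
  have "\<forall>\<^sub>F \<epsilon> in nhds 0. (- 1) ^ k * s * Re (poly (F \<epsilon>) (of_real (x k))) > 0" if k: "k < n" for k
  proof -
    have "((\<lambda>\<epsilon>. (- 1) ^ k * s * Re (poly (F \<epsilon>) (of_real (x k)))) \<longlongrightarrow>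
        (- 1) ^ k * s * Re (poly (F 0) (of_real (x k)))) (nhds 0)"
      unfolding F_def poly_add poly_smult by (intro tendsto_intros filterlim_ident)
    then show ?thesis
      by (rule order_tendstoD(1)) (use alt[OF k] in \<open>simp add: F_def\<close>)
  qed
  then have "\<forall>\<^sub>F \<epsilon> in nhds 0. \<forall>k\<in>{..<n}. (- 1) ^ k * s * Re (poly (F \<epsilon>) (of_real (x k))) > 0"
    by (intro eventually_ball_finite) auto
  then show ?thesis
  proof (rule eventually_mono)
    fix \<epsilon> assume *: "\<forall>k\<in>{..<n}. (- 1) ^ k * s * Re (poly (F \<epsilon>) (of_real (x k))) > 0"
    have "real_poly (F \<epsilon>)"
      unfolding F_def by (intro real_poly_add real_poly_smult real_poly_pencil h) auto
    moreover have "degree (F \<epsilon>) \<le> n"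
      unfolding F_def by (intro degree_add_le degree_pencil order_trans[OF degree_smult_le] h)
    ultimately show "pencil n c w + smult (of_real \<epsilon>) h \<in> pi_n_set n \<real>"
      using real_rooted_if_alternating[of "F \<epsilon>" n x s] n dec * by (simp add: F_def)
  qed
qed

section \<open>Classification of preservers\<close>

text \<open>A complex multiple of a real polynomial, expressed by identities quadratic in the
  coefficients and their conjugates. This form can be expanded in powers of a perturbation
  parameter.\<close>

definition real_direction :: "complex poly \<Rightarrow> bool" where
  "real_direction p \<longleftrightarrow> (\<forall>i j. coeff p i * cnj (coeff p j) \<in> \<real>)"

lemma real_direction_0 [simp]: "real_direction 0"
  by (simp add: real_direction_def)

lemma real_direction_smult: "real_direction p \<Longrightarrow> real_direction (smult c p)"
proof -
  assume p: "real_direction p"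
  have "(c * a) * cnj (c * b) = (c * cnj c) * (a * cnj b)" for a b
    by (simp add: mult_ac)
  moreover have "c * cnj c \<in> \<real>"
    by (simp add: complex_mult_cnj)
  ultimately show ?thesis
    using p unfolding real_direction_def coeff_smult by (metis Reals_mult)
qed

lemma real_poly_imp_real_direction: "real_poly p \<Longrightarrow> real_direction p"
  by (auto simp: real_poly_def real_direction_def intro!: Reals_mult simp: Reals_cnj_iff)

lemma real_direction_normalize:
  assumes "real_direction p" "p \<noteq> 0"
  shows "real_poly (smult (inverse (lead_coeff p)) p)"
proof -
  have "coeff p i * cnj (lead_coeff p) / (lead_coeff p * cnj (lead_coeff p)) \<in> \<real>" for i
    using assms(1) unfolding real_direction_def by (intro Reals_divide) blast+
  moreover have "coeff p i * cnj (lead_coeff p) / (lead_coeff p * cnj (lead_coeff p))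
      = inverse (lead_coeff p) * coeff p i" for i
    using assms(2) by (simp add: field_simps)
  ultimately show ?thesis
    unfolding real_poly_def coeff_smult by metis
qed

lemma real_rooted_real_direction:
  assumes "p \<in> pi_set \<real> \<union> {0}"
  shows "real_direction p"
proof (cases "p = 0")
  case False
  then have "\<And>u. poly p u = 0 \<Longrightarrow> u \<in> \<real>" using assms by (auto simp: pi_set_def)
  then obtain g where "p = smult (lead_coeff p) g" "real_poly g"
    using real_rooted_smult_real[of p] by metis
  then show ?thesis
    using real_direction_smult[OF real_poly_imp_real_direction] by metis
qed simp

lemma lin_op_on_add_smult:
  assumes "lin_op_on n T" "degree f \<le> n" "degree g \<le> n"
  shows "T (smult a f + smult b g) = smult a (T f) + smult b (T g)"
  using assms by (simp add: lin_op_on_add[OF assms(1)] lin_op_on_smult[OF assms(1)]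
      order_trans[OF degree_smult_le])

lemma pi_n_set_0I: "degree h = 0 \<Longrightarrow> h \<noteq> 0 \<Longrightarrow> h \<in> pi_n_set 0 \<real>"
  by (elim degree_eq_zeroE) (auto simp: pi_n_set_def pi_set_def)

text \<open>h need not be real-rooted, but g + \<epsilon>h is for all small \<epsilon> of either
  sign. The identities for its image are quadratic in \<epsilon>, and the coefficient of
  \<epsilon>^2 involves h alone.\<close>

lemma preserver_real_direction:
  assumes T: "lin_op_on n T"
    and pres: "\<And>f. f \<in> pi_n_set n \<real> \<Longrightarrow> T f \<in> pi_set \<real> \<union> {0}"
    and h: "degree h \<le> n" "real_poly h"
  shows "real_direction (T h)"
proof (cases "n = 0")
  case True
  show ?thesis
  proof (cases "h = 0")
    case False
    with True h(1) show ?thesis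
      by (intro real_rooted_real_direction pres) (simp add: pi_n_set_0I)
  qed (simp add: lin_op_on_0[OF T])
next
  case False
  define g where "g = pencil n 1 \<i>"
  have "\<forall>\<^sub>F \<epsilon> :: real in nhds 0. g + smult (of_real \<epsilon>) h \<in> pi_n_set n \<real>"
    unfolding g_def using False h by (intro pencil_perturb) auto
  then obtain d where d: "d > 0" "\<And>\<epsilon>::real. dist \<epsilon> 0 < d \<Longrightarrow> g + smult (of_real \<epsilon>) h \<in> pi_n_set n \<real>"
    unfolding eventually_nhds_metric by blast
  have dg: "degree g \<le> n" unfolding g_def by (rule degree_pencil)
  have rd: "real_direction (T g + smult (of_real \<epsilon>) (T h))" if "\<bar>\<epsilon>\<bar> < d" for \<epsilon> :: real
    using real_rooted_real_direction[OF pres[OF d(2)[of \<epsilon>]]] that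
      lin_op_on_add_smult[OF T dg h(1), of 1 "of_real \<epsilon>"] by simp
  have "Im (coeff (T h) i * cnj (coeff (T h) j)) = 0" for i j
  proof -
    define a where "a = coeff (T g) i"
    define b where "b = coeff (T g) j"
    define p where "p = coeff (T h) i"
    define q where "q = coeff (T h) j"
    define e where "e = d / 2"
    have I: "Im ((a + of_real \<epsilon> * p) * cnj (b + of_real \<epsilon> * q)) = 0" if "\<bar>\<epsilon>\<bar> < d" for \<epsilon>
      using rd[OF that] by (auto simp: real_direction_def a_def b_def p_def q_def complex_is_Real_iff)
    \<comment> \<open>A second difference isolates the coefficient of \<epsilon>^2.\<close>
    have "Im ((a + of_real e * p) * cnj (b + of_real e * q)) + Im ((a + of_real (- e) * p) * cnj (b + of_real (- e) * q))
        = 2 * Im ((a + of_real 0 * p) * cnj (b + of_real 0 * q)) + 2 * e\<^sup>2 * Im (p * cnj q)"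
      by (simp add: algebra_simps power2_eq_square)
    then have "2 * e\<^sup>2 * Im (p * cnj q) = 0"
      using I[of e] I[of "- e"] I[of 0] d(1) by (simp add: e_def)
    then show ?thesis using d(1) by (simp add: e_def p_def q_def)
  qed
  then show ?thesis by (simp add: real_direction_def complex_is_Real_iff)
qed

lemma rank_one_functional:
  assumes T: "lin_op_on n T" and P: "P \<noteq> 0"
    and mon: "\<And>k. k \<le> n \<Longrightarrow> \<exists>\<mu>. T (monom 1 k) = smult \<mu> P"
  shows "\<exists>\<alpha>. lin_fun_on n \<alpha> \<and> (\<forall>f\<in>Cn n. T f = smult (\<alpha> f) P)"
proof -
  define \<alpha> where "\<alpha> f = coeff (T f) (degree P) / lead_coeff P" for f
  have "lin_fun_on n \<alpha>"
    using T by (simp add: lin_op_on_def lin_fun_on_def \<alpha>_def add_divide_distrib)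
  moreover have "T f = smult (\<alpha> f) P" if f: "f \<in> Cn n" for f
  proof -
    obtain \<mu> where \<mu>: "\<And>k. k \<le> n \<Longrightarrow> T (monom 1 k) = smult (\<mu> k) P"
      using mon by metis
    have "T f = (\<Sum>j\<le>n. smult (coeff f j * \<mu> j) P)"
      using lin_op_on_monoms[OF T, of f] f \<mu> by (simp add: Cn_def)
    also have "\<dots> = smult (\<Sum>j\<le>n. coeff f j * \<mu> j) P"
      by (simp add: smult_sum)
    finally show ?thesis using P by (simp add: \<alpha>_def)
  qed
  ultimately show ?thesis by blast
qed

text \<open>If \<open>S y\<close> = c Q with Q real and c non-real, the sum P + c Q can only be a
  multiple of a real polynomial when Q is parallel to P. One such \<open>y0\<close> suffices: for y
  with real image, y + \<open>y0\<close> again has a non-real image.\<close>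

lemma real_or_rank_one:
  assumes S: "lin_op_on n S"
    and rd: "\<And>h. degree h \<le> n \<Longrightarrow> real_poly h \<Longrightarrow> real_direction (S h)"
    and h0: "degree h0 \<le> n" "real_poly h0" "real_poly (S h0)" "S h0 \<noteq> 0"
  shows "(\<forall>h. degree h \<le> n \<longrightarrow> real_poly h \<longrightarrow> real_poly (S h)) \<or>
    (\<forall>h. degree h \<le> n \<longrightarrow> real_poly h \<longrightarrow> (\<exists>\<mu>. S h = smult \<mu> (S h0)))"
proof -
  define P where "P = S h0"
  define m where "m = degree P"
  have pm: "coeff P m \<noteq> 0" using h0 by (simp add: P_def m_def)
  have nonreal: "\<exists>\<mu>. S y = smult \<mu> P" if y: "degree y \<le> n" "real_poly y" "\<not> real_poly (S y)" for y
  proof -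
    have Sy0: "S y \<noteq> 0" using y(3) by auto
    define c where "c = lead_coeff (S y)"
    define Q where "Q = smult (inverse c) (S y)"
    have c0: "c \<noteq> 0" using Sy0 by (simp add: c_def)
    have Q: "real_poly Q"
      unfolding Q_def c_def by (rule real_direction_normalize[OF rd[OF y(1,2)] Sy0])
    have SyQ: "S y = smult c Q" using c0 by (simp add: Q_def)
    have "c \<notin> \<real>" using y(3) Q real_poly_smult SyQ by metis
    then have cI: "Im c \<noteq> 0" by (simp add: complex_is_Real_iff)
    have "real_direction (S (h0 + y))"
      using h0 y by (intro rd degree_add_le real_poly_add) auto
    then have rdPQ: "real_direction (P + smult c Q)"
      using h0 y by (simp add: lin_op_on_add[OF S] P_def SyQ)
    have rel: "coeff Q i * coeff P m = coeff P i * coeff Q m" for i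
    proof -
      define a b p q where "a = Re (coeff P i)" and "b = Re (coeff P m)" and "p = Re (coeff Q i)" and "q = Re (coeff Q m)"
      have r: "coeff P i = of_real a" "coeff P m = of_real b" "coeff Q i = of_real p" "coeff Q m = of_real q"
        using Q h0(3) by (simp_all add: a_def b_def p_def q_def P_def real_poly_def complex_is_Real_iff complex_eq_iff)
      have "(coeff P i + c * coeff Q i) * cnj (coeff P m + c * coeff Q m) \<in> \<real>"
        using rdPQ by (simp add: real_direction_def)
      then have "Im ((of_real a + c * of_real p) * cnj (of_real b + c * of_real q)) = 0"
        unfolding r by (simp only: complex_is_Real_iff)
      moreover have "Im ((of_real a + c * of_real p) * cnj (of_real b + c * of_real q)) = Im c * (p * b - a * q)"
        by (simp add: algebra_simps)
      ultimately have "Im c * (p * b - a * q) = 0" by metis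
      then have "p * b = a * q" using cI by simp
      then show ?thesis unfolding r by (simp flip: of_real_mult)
    qed
    have "S y = smult (c * coeff Q m / coeff P m) P"
      unfolding SyQ using rel pm by (intro poly_eqI) (simp add: field_simps)
    then show ?thesis by blast
  qed
  show ?thesis
  proof (cases "\<forall>h. degree h \<le> n \<longrightarrow> real_poly h \<longrightarrow> real_poly (S h)")
    case False
    then obtain y0 where y0: "degree y0 \<le> n" "real_poly y0" "\<not> real_poly (S y0)" by blast
    have "\<exists>\<mu>. S y = smult \<mu> P" if y: "degree y \<le> n" "real_poly y" for y
    proof (cases "real_poly (S y)")
      case True
      have add: "S (y + y0) = S y + S y0" using y y0 by (simp add: lin_op_on_add[OF S])
      have "\<not> real_poly (S (y + y0))"
      proof
        assume "real_poly (S (y + y0))"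
        then have "real_poly (S (y + y0) + smult (- 1) (S y))"
          using True by (intro real_poly_add real_poly_smult) auto
        then show False using y0(3) by (simp add: add)
      qed
      then obtain \<mu> where "S (y + y0) = smult \<mu> P"
        using nonreal[of "y + y0"] y y0 by (auto intro: degree_add_le real_poly_add)
      moreover obtain \<nu> where "S y0 = smult \<nu> P" using nonreal[OF y0] by blast
      ultimately have "S y = smult (\<mu> - \<nu>) P"
        by (simp add: add smult_diff_left) (metis add_diff_cancel_right')
      then show ?thesis by blast
    qed (use nonreal y in blast)
    then show ?thesis by (auto simp: P_def)
  qed blast
qed

text \<open>\<open>Im (cnj u * v)\<close> is the determinant of u and v regarded as vectors in the
  real plane.\<close>

lemma real_dependent_if:
  fixes u v :: complex
  assumes "Im (cnj u * v) = 0"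
  obtains a b :: real where "a \<noteq> 0 \<or> b \<noteq> 0" "of_real a * u + of_real b * v = 0"
proof (cases "u = 0")
  case True
  then show ?thesis using that[of 1 0] by simp
next
  case False
  define \<kappa> where "\<kappa> = Re (cnj u * v)"
  have \<kappa>: "cnj u * v = of_real \<kappa>"
    using assms by (simp add: complex_eq_iff \<kappa>_def)
  have "of_real ((norm u)\<^sup>2) * v = u * (cnj u * v)"
    by (simp only: complex_norm_square mult.assoc)
  then have "of_real (- \<kappa>) * u + of_real ((norm u)\<^sup>2) * v = 0"
    by (simp only: \<kappa>) (simp add: mult.commute)
  then show ?thesis using that False by (metis norm_eq_zero power_eq_0_iff)
qed

lemma real_dependent_imp:
  fixes u v :: complex and a b :: real
  assumes "a \<noteq> 0 \<or> b \<noteq> 0" "of_real a * u + of_real b * v = 0"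
  shows "Im (cnj u * v) = 0"
proof -
  have e: "a * Re u + b * Re v = 0" "a * Im u + b * Im v = 0"
    using assms(2) by (auto simp: complex_eq_iff)
  have "a * Im (cnj u * v) = (a * Re u + b * Re v) * Im v - (a * Im u + b * Im v) * Re v"
    by (simp add: algebra_simps)
  moreover have "b * Im (cnj u * v) = (a * Im u + b * Im v) * Re u - (a * Re u + b * Re v) * Im u"
    by (simp add: algebra_simps)
  ultimately show ?thesis using assms(1) e by auto
qed

text \<open>A real polynomial with only real zeros is determined, within a real space of such polynomials, by its
  value at \<open>\<i>\<close>, so the range has real dimension at most two.\<close>

lemma rank_two_if_all_real_rooted:
  assumes S: "lin_op_on n S"
    and real: "\<And>h. degree h \<le> n \<Longrightarrow> real_poly h \<Longrightarrow> real_poly (S h)"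
    and rr: "\<And>h. degree h \<le> n \<Longrightarrow> real_poly h \<Longrightarrow> S h \<in> pi_set \<real> \<union> {0}"
    and h0: "degree h0 \<le> n" "real_poly h0" "S h0 \<noteq> 0"
  shows "(\<forall>h. degree h \<le> n \<longrightarrow> real_poly h \<longrightarrow> (\<exists>\<mu>. S h = smult \<mu> (S h0))) \<or>
    (\<exists>\<alpha> \<beta> P Q. lin_fun_on n \<alpha> \<and> lin_fun_on n \<beta> \<and>
      (\<forall>f\<in>Cn n. real_poly f \<longrightarrow> \<alpha> f \<in> \<real>) \<and> (\<forall>f\<in>Cn n. real_poly f \<longrightarrow> \<beta> f \<in> \<real>) \<and>
      P \<in> H1R \<and> Q \<in> H1R \<and> zeros_interlace P Q \<and>
      (\<forall>f\<in>Cn n. S f = smult (\<alpha> f) P + smult (\<beta> f) Q))"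
proof -
  have comb: "smult (of_real a) (S f) + smult (of_real b) (S g) = 0"
    if f: "degree f \<le> n" "real_poly f" and g: "degree g \<le> n" "real_poly g" and z: "Im z \<noteq> 0"
      and eq: "of_real a * poly (S f) z + of_real b * poly (S g) z = 0" for f g z and a b :: real
  proof -
    define F where "F = smult (of_real a) f + smult (of_real b) g"
    have F: "degree F \<le> n" "real_poly F"
      unfolding F_def using f g
      by (auto intro!: degree_add_le order_trans[OF degree_smult_le] real_poly_add real_poly_smult)
    have SF: "S F = smult (of_real a) (S f) + smult (of_real b) (S g)"
      unfolding F_def by (rule lin_op_on_add_smult[OF S f(1) g(1)])
    then have "poly (S F) z = 0" using eq by simp
    moreover have "z \<notin> \<real>" using z by (simp add: complex_is_Real_iff)
    ultimately have "S F = 0" using rr[OF F] by (auto simp: pi_set_def)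
    then show ?thesis by (simp add: SF)
  qed
  show ?thesis
  proof (cases "\<forall>h. degree h \<le> n \<longrightarrow> real_poly h \<longrightarrow> Im (cnj (poly (S h0) \<i>) * poly (S h) \<i>) = 0")
    case True
    have "\<exists>\<mu>. S h = smult \<mu> (S h0)" if h: "degree h \<le> n" "real_poly h" for h
    proof -
      obtain a b where ab: "a \<noteq> 0 \<or> b \<noteq> 0" "of_real a * poly (S h0) \<i> + of_real b * poly (S h) \<i> = 0"
        using real_dependent_if True h by metis
      have 0: "smult (of_real a) (S h0) + smult (of_real b) (S h) = 0"
        by (rule comb[OF h0(1,2) h _ ab(2)]) simp
      then have "b \<noteq> 0" using ab(1) h0(3) by auto
      have "S h = smult (- of_real a / of_real b) (S h0)"
      proof (rule poly_eqI)
        fix i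
        show "coeff (S h) i = coeff (smult (- of_real a / of_real b) (S h0)) i"
          using arg_cong[OF 0, of "\<lambda>p. coeff p i"] \<open>b \<noteq> 0\<close>
          by (simp add: field_simps) (metis add_eq_0_iff)
      qed
      then show ?thesis by blast
    qed
    then show ?thesis by blast
  next
    case False
    then obtain h1 where h1: "degree h1 \<le> n" "real_poly h1"
      and ind: "Im (cnj (poly (S h0) \<i>) * poly (S h1) \<i>) \<noteq> 0" by blast
    define P where "P = S h0"
    define Q where "Q = S h1"
    have "Q \<noteq> 0" using ind by (auto simp: Q_def)
    then have PQ: "P \<in> H1R" "Q \<in> H1R"
      using real rr h0 h1 by (auto simp: P_def Q_def H1R_def)
    have "zeros_interlace P Q"
    \<comment> \<open>Independence at \<i> spreads to every z: by \<open>comb\<close>, a real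
      relation between the values at z is a relation between the polynomials, hence one at
      \<i>.\<close>
    proof (rule interlace_if_no_real_ratio[OF PQ], rule notI)
      fix z assume z: "Im z > 0" and "Im (cnj (poly P z) * poly Q z) = 0"
      then obtain a b where ab: "a \<noteq> 0 \<or> b \<noteq> 0" "of_real a * poly P z + of_real b * poly Q z = 0"
        using real_dependent_if by metis
      have "smult (of_real a) P + smult (of_real b) Q = 0"
        using comb[OF h0(1,2) h1 _ ab(2)[unfolded P_def Q_def]] z by (simp add: P_def Q_def)
      then have "of_real a * poly P \<i> + of_real b * poly Q \<i> = 0"
        by (metis poly_0 poly_add poly_smult)
      then have "Im (cnj (poly P \<i>) * poly Q \<i>) = 0"
        using real_dependent_imp[OF ab(1)] by blast
      then show False using ind by (simp add: P_def Q_def)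
    qed
    define p where "p = poly P \<i>"
    define q where "q = poly Q \<i>"
    \<comment> \<open>Cramer's rule for the system expressing the values of \<open>S f\<close> at
      \<i> and -\<i> through those of P and Q. The value at -\<i> replaces a conjugate, which keeps
      \<alpha> and \<beta> complex-linear.\<close>
    define \<Delta> where "\<Delta> = p * cnj q - cnj p * q"
    have \<Delta>: "\<Delta> = of_real (- 2 * Im (cnj p * q)) * \<i>"
      by (simp add: \<Delta>_def complex_eq_iff algebra_simps)
    have \<Delta>0: "\<Delta> \<noteq> 0" using ind by (simp add: \<Delta> p_def q_def P_def Q_def del: times_complex.sel)
    define \<alpha> where "\<alpha> f = (poly (S f) \<i> * cnj q - poly (S f) (- \<i>) * q) / \<Delta>" for f
    define \<beta> where "\<beta> f = (p * poly (S f) (- \<i>) - cnj p * poly (S f) \<i>) / \<Delta>" for f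
    have lin: "lin_fun_on n \<alpha>" "lin_fun_on n \<beta>"
      using S by (simp_all add: lin_op_on_def lin_fun_on_def \<alpha>_def \<beta>_def
          add_divide_distrib diff_divide_distrib algebra_simps)
    \<comment> \<open>\<Delta> is purely imaginary, and for real f so are both numerators.\<close>
    have ratio: "u / \<Delta> \<in> \<real>" if "Re u = 0" for u
    proof -
      have "u = of_real (Im u) * \<i>" using that by (simp add: complex_eq_iff)
      then have "u / \<Delta> = of_real (Im u / (- 2 * Im (cnj p * q)))"
        unfolding \<Delta> by (metis complex_i_not_zero mult_divide_mult_cancel_right of_real_divide)
      then show ?thesis by (metis Reals_of_real)
    qed
    have cnjS: "poly (S f) (- \<i>) = cnj (poly (S f) \<i>)" if "f \<in> Cn n" "real_poly f" for f
      using poly_real_cnj[of "S f" \<i>] real that by (simp add: Cn_def)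
    have \<alpha>R: "\<alpha> f \<in> \<real>" and \<beta>R: "\<beta> f \<in> \<real>" if "f \<in> Cn n" "real_poly f" for f
      unfolding \<alpha>_def \<beta>_def cnjS[OF that] by (auto intro!: ratio)
    have rep: "S f = smult (\<alpha> f) P + smult (\<beta> f) Q" if f: "f \<in> Cn n" "real_poly f" for f
    proof -
      obtain a b :: real where ab: "\<alpha> f = of_real a" "\<beta> f = of_real b"
        using \<alpha>R[OF f] \<beta>R[OF f] by (metis Reals_cases)
      define F where "F = smult (of_real a) h0 + smult (of_real b) h1"
      have F: "degree F \<le> n" "real_poly F"
        unfolding F_def using h0 h1
        by (auto intro!: degree_add_le order_trans[OF degree_smult_le] real_poly_add real_poly_smult)
      have SF: "S F = smult (\<alpha> f) P + smult (\<beta> f) Q"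
        unfolding F_def ab P_def Q_def by (rule lin_op_on_add_smult[OF S h0(1) h1(1)])
      have "\<alpha> f * p + \<beta> f * q = poly (S f) \<i> * \<Delta> / \<Delta>"
        unfolding \<alpha>_def \<beta>_def times_divide_eq_left add_divide_distrib[symmetric]
        by (rule arg_cong[of _ _ "\<lambda>x. x / \<Delta>"]) (simp add: \<Delta>_def algebra_simps)
      then have "poly (S f) \<i> = poly (S F) \<i>" using \<Delta>0 by (simp add: SF p_def q_def)
      then have "smult (of_real 1) (S f) + smult (of_real (- 1)) (S F) = 0"
        using f by (intro comb[of f F \<i> 1 "- 1"] F) (auto simp: Cn_def)
      then have "S f = S F" by simp
      then show ?thesis unfolding SF .
    qed
    \<comment> \<open>The representation \<open>rep\<close> is limited to real f; agreement on
      monomials extends it to all of \<open>Cn n\<close>.\<close>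
    define R where "R f = smult (\<alpha> f) P + smult (\<beta> f) Q" for f
    have R: "lin_op_on n R"
      using lin by (simp add: lin_op_on_def lin_fun_on_def R_def smult_add_left smult_add_right algebra_simps)
    have "S f = R f" if f: "f \<in> Cn n" for f
    proof -
      have "S (monom 1 k) = R (monom 1 k)" if "k \<le> n" for k
        unfolding R_def using that by (intro rep) (simp_all add: Cn_def degree_monom_eq)
      then show ?thesis
        using lin_op_on_monoms[OF S, of f] lin_op_on_monoms[OF R, of f] f by (simp add: Cn_def)
    qed
    then show ?thesis
      using lin \<alpha>R \<beta>R PQ \<open>zeros_interlace P Q\<close> unfolding R_def by blast
  qed
qed

text \<open>The choice c = cnj u - v works by cancellation unless it is 0. In that case v = cnj u,
  and c = \<i> cnj u makes the two terms opposite.\<close>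

lemma complex_combination_eq_0:
  fixes u v :: complex
  assumes "norm u = norm v"
  obtains c where "c \<noteq> 0" "c * u + cnj c * v = 0"
proof -
  have uv: "u * cnj u = v * cnj v"
    using assms by (simp flip: complex_norm_square)
  consider "cnj u \<noteq> v" | "cnj u = v" "u \<noteq> 0" | "u = 0" "v = 0" using assms by force
  then show ?thesis
  proof cases
    case 1
    have "(cnj u - v) * u + cnj (cnj u - v) * v = 0"
      using uv by (simp add: algebra_simps)
    moreover have "cnj u - v \<noteq> 0" using 1 by simp
    ultimately show ?thesis using that by blast
  next
    case 2
    have "(\<i> * cnj u) * u + cnj (\<i> * cnj u) * v = 0"
      using 2(1)[symmetric] by simp
    moreover have "\<i> * cnj u \<noteq> 0" using 2(2) by simp
    ultimately show ?thesis using that by blast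
  qed (use that[of 1] in auto)
qed

text \<open>A polynomial of the pencil in the kernel would put the whole real range into \<open>pi_set \<real>\<close>, because it
  remains real-rooted under all small real perturbations.\<close>

lemma symbol_nonvanishing:
  assumes S: "lin_op_on n S"
    and pres: "\<And>f. f \<in> pi_n_set n \<real> \<Longrightarrow> S f \<in> pi_set \<real> \<union> {0}"
    and h: "degree h \<le> n" "real_poly h" "S h \<notin> pi_set \<real> \<union> {0}"
  shows "(\<forall>z w. Im z > 0 \<longrightarrow> Im w > 0 \<longrightarrow> poly (S ([:w, 1:] ^ n)) z \<noteq> 0) \<or>
    (\<forall>z w. Im z > 0 \<longrightarrow> Im w > 0 \<longrightarrow> poly (S ([:- w, 1:] ^ n)) z \<noteq> 0)"
proof -
  \<comment> \<open>The perturbation argument requires n > 0; for n = 0 every non-zero constant is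
    real-rooted, so no such h exists.\<close>
  have "n \<noteq> 0"
  proof
    assume "n = 0"
    then have "h \<in> pi_n_set n \<real>"
      using h lin_op_on_0[OF S] by (cases "h = 0") (auto intro: pi_n_set_0I)
    then show False using pres h(3) by blast
  qed
  have pw: "degree ([:w, 1:] ^ n :: complex poly) \<le> n" for w :: complex
    by (simp add: degree_power_eq)
  define U where "U z w = poly (S ([:w, 1:] ^ n)) z" for z w
  have Spencil: "S (pencil n c w) = smult c (S ([:w, 1:] ^ n)) + smult (cnj c) (S ([:cnj w, 1:] ^ n))" for c w
    unfolding pencil_def by (rule lin_op_on_add_smult[OF S pw pw])
  have ne: "norm (U z w) \<noteq> norm (U z (cnj w))" if z: "Im z > 0" and w: "Im w > 0" for z w
  proof
    assume "norm (U z w) = norm (U z (cnj w))"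
    then obtain c where c: "c \<noteq> 0" "c * U z w + cnj c * U z (cnj w) = 0"
      by (rule complex_combination_eq_0)
    have ev: "\<forall>\<^sub>F \<epsilon> :: real in nhds 0. pencil n c w + smult (of_real \<epsilon>) h \<in> pi_n_set n \<real>"
      using \<open>n \<noteq> 0\<close> c w h by (intro pencil_perturb) auto
    then obtain d where d: "d > 0" "\<And>\<epsilon>::real. dist \<epsilon> 0 < d \<Longrightarrow> pencil n c w + smult (of_real \<epsilon>) h \<in> pi_n_set n \<real>"
      unfolding eventually_nhds_metric by blast
    have "pencil n c w \<in> pi_n_set n \<real>" using d(2)[of 0] d(1) by simp
    moreover have "poly (S (pencil n c w)) z = 0" using c(2) by (simp add: Spencil U_def)
    moreover have "z \<notin> \<real>" using z by (simp add: complex_is_Real_iff)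
    ultimately have S0: "S (pencil n c w) = 0" using pres by (auto simp: pi_set_def)
    have "S (pencil n c w + smult (of_real (d / 2)) h) = smult (of_real (d / 2)) (S h)"
      using lin_op_on_add_smult[OF S degree_pencil h(1), of 1] S0 by simp
    then have "smult (of_real (d / 2)) (S h) \<in> pi_set \<real> \<union> {0}"
      using pres[OF d(2)[of "d / 2"]] d(1) by simp
    then have "S h \<in> pi_set \<real> \<union> {0}" using d(1) by (auto simp: pi_set_def)
    then show False using h(3) by blast
  qed
  define K where "K = {z. Im z > 0} \<times> {w. Im w > 0}"
  have exp: "U z w = (\<Sum>j\<le>n. of_nat (n choose j) * w ^ j * poly (S ([:0, 1:] ^ (n - j))) z)" for z w
    unfolding U_def
    using lin_fun_on_linear_power[OF lin_fun_on_poly[OF S, of z], of 1 n w] by simp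
  have cont: "continuous_on K (\<lambda>x. norm (U (fst x) (snd x)) - norm (U (fst x) (cnj (snd x))))"
    unfolding exp by (intro continuous_intros)
  have "connected K"
    unfolding K_def by (intro connected_Times connected_upper_half_plane)
  then have conn: "connected ((\<lambda>x. norm (U (fst x) (snd x)) - norm (U (fst x) (cnj (snd x)))) ` K)"
    (is "connected (?f ` K)")
    using connected_continuous_image[OF cont] by blast
  have "(\<forall>x\<in>K. ?f x > 0) \<or> (\<forall>x\<in>K. ?f x < 0)"
  proof (rule ccontr)
    assume "\<not> ?thesis"
    then obtain x y where xy: "x \<in> K" "y \<in> K" "?f x \<le> 0" "?f y \<ge> 0" by (meson not_le)
    have "{?f x..?f y} \<subseteq> ?f ` K"
      using conn xy by (intro connected_contains_Icc) blast+
    then have "0 \<in> ?f ` K" using xy by auto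
    then show False using ne by (auto simp: K_def)
  qed
  then show ?thesis
  proof
    assume *: "\<forall>x\<in>K. ?f x > 0"
    have "U z w \<noteq> 0" if "Im z > 0" "Im w > 0" for z w
      using *[rule_format, of "(z, w)"] that by (auto simp: K_def)
    then show ?thesis by (simp add: U_def)
  next
    assume *: "\<forall>x\<in>K. ?f x < 0"
    have "U z (- w) \<noteq> 0" if "Im z > 0" "Im w > 0" for z w
      \<comment> \<open>-cnj w lies in the upper half plane and its conjugate is -w, so the
        dominating side is the one evaluated at -w.\<close>
      using *[rule_format, of "(z, - cnj w)"] that by (auto simp: K_def)
    then show ?thesis by (simp add: U_def)
  qed
qed

section \<open>Assembling the equivalence\<close>

lemma range_dim_le_1:
  assumes "\<forall>f\<in>Cn n. T f = smult (\<alpha> f) P"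
  shows "range_dim_le 1 n T"
  unfolding range_dim_le_def
proof (intro exI conjI ballI)
  fix f assume "f \<in> Cn n"
  then show "T f = (\<Sum>i<length [P]. smult ([\<alpha> f] ! i) ([P] ! i))" using assms by simp
qed simp_all

lemma range_dim_le_2:
  assumes "\<forall>f\<in>Cn n. T f = smult (\<alpha> f) P + smult (\<beta> f) Q"
  shows "range_dim_le 2 n T"
  unfolding range_dim_le_def
proof (intro exI conjI ballI)
  fix f assume "f \<in> Cn n"
  then show "T f = (\<Sum>i<length [P, Q]. smult ([\<alpha> f, \<beta> f] ! i) ([P, Q] ! i))" using assms by simp
qed simp_all

lemma interlacing_pair_preserves_real_rooted:
  assumes PQ: "P \<in> H1R" "Q \<in> H1R" "zeros_interlace P Q"
    and \<alpha>: "lin_fun_on n \<alpha>" "\<forall>f\<in>Cn n. real_poly f \<longrightarrow> \<alpha> f \<in> \<real>"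
    and \<beta>: "lin_fun_on n \<beta>" "\<forall>f\<in>Cn n. real_poly f \<longrightarrow> \<beta> f \<in> \<real>"
    and f: "f \<in> pi_n_set n \<real>"
  shows "smult (\<eta> * \<alpha> f) P + smult (\<eta> * \<beta> f) Q \<in> pi_set \<real> \<union> {0}"
proof -
  obtain g where g: "f = smult (lead_coeff f) g" "real_poly g" "degree g \<le> degree f"
    using real_rooted_smult_real[of f] f by (auto simp: pi_n_set_def pi_set_def)
  have gC: "g \<in> Cn n" using g(3) f by (simp add: Cn_def pi_n_set_def)
  obtain a b :: real where ab: "\<alpha> g = of_real a" "\<beta> g = of_real b"
    using \<alpha>(2) \<beta>(2) gC g(2) by (metis Reals_cases)
  have "\<alpha> f = lead_coeff f * \<alpha> g" "\<beta> f = lead_coeff f * \<beta> g"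
    using \<alpha>(1) \<beta>(1) gC g(1) unfolding lin_fun_on_def by metis+
  define R where "R = smult (of_real a) P + smult (of_real b) Q"
  have eq: "smult (\<eta> * \<alpha> f) P + smult (\<eta> * \<beta> f) Q = smult (\<eta> * lead_coeff f) R"
    by (simp add: R_def \<open>\<alpha> f = _\<close> \<open>\<beta> f = _\<close> ab smult_add_right mult_ac)
  have up: "R = 0" if "Im z > 0" "poly R z = 0" for z
    using interlace_combination[OF PQ that(1), of a b] that(2) by (simp add: R_def)
  have R: "real_poly R"
    using PQ unfolding R_def H1R_def by (intro real_poly_add real_poly_smult) auto
  have "R = 0" if "poly R z = 0" "z \<notin> \<real>" for z
  proof (cases "Im z > 0")
    case False
    then have "Im (cnj z) > 0" using that(2) by (auto simp: complex_is_Real_iff)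
    moreover have "poly R (cnj z) = 0" using that(1) R by (simp add: poly_real_cnj)
    ultimately show ?thesis by (rule up)
  qed (use up that in blast)
  then show ?thesis unfolding eq by (auto simp: pi_set_def)
qed

lemma preserver_classification:
  assumes T: "lin_op_on n T"
    and pres: "\<And>f. f \<in> pi_n_set n \<real> \<Longrightarrow> T f \<in> pi_set \<real> \<union> {0}"
  shows "(\<exists>\<alpha> P. lin_fun_on n \<alpha> \<and> P \<in> H1R \<and> (\<forall>f\<in>Cn n. T f = smult (\<alpha> f) P)) \<or>
    (\<exists>\<eta> \<alpha> \<beta> P Q. lin_fun_on n \<alpha> \<and> lin_fun_on n \<beta> \<and>
      (\<forall>f\<in>Cn n. real_poly f \<longrightarrow> \<alpha> f \<in> \<real>) \<and> (\<forall>f\<in>Cn n. real_poly f \<longrightarrow> \<beta> f \<in> \<real>) \<and>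
      P \<in> H1R \<and> Q \<in> H1R \<and> zeros_interlace P Q \<and>
      (\<forall>f\<in>Cn n. T f = smult (\<eta> * \<alpha> f) P + smult (\<eta> * \<beta> f) Q)) \<or>
    (\<exists>\<eta>. smult [:\<eta>:] (extT T (z_plus_w ^ n)) \<in> H2R) \<or>
    (\<exists>\<eta>. smult [:\<eta>:] (extT T (z_minus_w ^ n)) \<in> H2R)"
    (is "?a \<or> ?b \<or> ?c \<or> ?d")
proof (cases "\<forall>k\<le>n. T (monom 1 k) = 0")
  case True
  \<comment> \<open>The zero operator falls under (a), with the constant 1 as P.\<close>
  then have "\<exists>\<alpha>. lin_fun_on n \<alpha> \<and> (\<forall>f\<in>Cn n. T f = smult (\<alpha> f) 1)"
    by (intro rank_one_functional[OF T]) (auto intro: exI[of _ 0])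
  moreover have "1 \<in> H1R" by (auto simp: H1R_def pi_set_def)
  ultimately show ?thesis by blast
next
  case False
  then obtain k where k: "k \<le> n" "T (monom 1 k) \<noteq> 0" by blast
  have rd: "real_direction (T h)" if "degree h \<le> n" "real_poly h" for h
    by (rule preserver_real_direction[OF T _ that]) (rule pres)
  have m: "degree (monom (1::complex) k) \<le> n" using k(1) by (simp add: degree_monom_eq)
  \<comment> \<open>Dividing by this leading coefficient makes one non-zero image real, the
    reference polynomial for \<open>real_or_rank_one\<close>. Its preimage is a monomial and thus
    real-rooted, which puts P into \<open>H1R\<close>.\<close>
  define \<eta> where "\<eta> = lead_coeff (T (monom 1 k))"
  have \<eta>0: "\<eta> \<noteq> 0" using k(2) by (simp add: \<eta>_def)
  define S where "S f = smult (inverse \<eta>) (T f)" for f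
  have TS: "T f = smult \<eta> (S f)" for f using \<eta>0 by (simp add: S_def)
  have S: "lin_op_on n S"
    using T by (simp add: S_def lin_op_on_def smult_add_right mult.commute)
  have Spres: "S f \<in> pi_set \<real> \<union> {0}" if "f \<in> pi_n_set n \<real>" for f
    using pres[OF that] \<eta>0 by (auto simp: S_def pi_set_def)
  have Srd: "real_direction (S h)" if "degree h \<le> n" "real_poly h" for h
    unfolding S_def using rd[OF that] by (rule real_direction_smult)
  define P where "P = S (monom 1 k)"
  have P0: "P \<noteq> 0" using k \<eta>0 by (simp add: P_def S_def)
  have Preal: "real_poly P"
    unfolding P_def S_def \<eta>_def by (rule real_direction_normalize[OF rd[OF m] k(2)]) simp
  have "monom 1 k \<in> pi_n_set n \<real>"
    using k(1) by (auto simp: pi_n_set_def pi_set_def poly_monom degree_monom_eq)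
  then have PH: "P \<in> H1R" using Spres P0 Preal by (auto simp: H1R_def P_def)
  have rank1: ?a if "\<And>h. degree h \<le> n \<Longrightarrow> real_poly h \<Longrightarrow> \<exists>\<mu>. S h = smult \<mu> P"
  proof -
    have "\<exists>\<mu>. T (monom 1 j) = smult \<mu> P" if "j \<le> n" for j
    proof -
      have "\<exists>\<mu>. S (monom 1 j) = smult \<mu> P"
        using \<open>\<And>h. degree h \<le> n \<Longrightarrow> real_poly h \<Longrightarrow> \<exists>\<mu>. S h = smult \<mu> P\<close>[of "monom 1 j"] that
        by (simp add: degree_monom_eq)
      then show ?thesis by (metis TS smult_smult)
    qed
    then show ?thesis using rank_one_functional[OF T P0] PH by blast
  qed
  consider "\<forall>h. degree h \<le> n \<longrightarrow> real_poly h \<longrightarrow> real_poly (S h)"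
    | "\<forall>h. degree h \<le> n \<longrightarrow> real_poly h \<longrightarrow> (\<exists>\<mu>. S h = smult \<mu> P)"
    using real_or_rank_one[OF S _ m real_poly_monom] Srd Preal P0 unfolding P_def by blast
  then show ?thesis
  proof cases
    case 1
    then have Sreal: "real_poly (S h)" if "degree h \<le> n" "real_poly h" for h using that by blast
    show ?thesis
    proof (cases "\<forall>h. degree h \<le> n \<longrightarrow> real_poly h \<longrightarrow> S h \<in> pi_set \<real> \<union> {0}")
      case True
      then have rr: "S h \<in> pi_set \<real> \<union> {0}" if "degree h \<le> n" "real_poly h" for h using that by blast
      have "(\<forall>h. degree h \<le> n \<longrightarrow> real_poly h \<longrightarrow> (\<exists>\<mu>. S h = smult \<mu> P)) \<or>
        (\<exists>\<alpha> \<beta> P Q. lin_fun_on n \<alpha> \<and> lin_fun_on n \<beta> \<and>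
          (\<forall>f\<in>Cn n. real_poly f \<longrightarrow> \<alpha> f \<in> \<real>) \<and> (\<forall>f\<in>Cn n. real_poly f \<longrightarrow> \<beta> f \<in> \<real>) \<and>
          P \<in> H1R \<and> Q \<in> H1R \<and> zeros_interlace P Q \<and>
          (\<forall>f\<in>Cn n. S f = smult (\<alpha> f) P + smult (\<beta> f) Q))"
        unfolding P_def
        by (rule rank_two_if_all_real_rooted[OF S _ _ m real_poly_monom P0[unfolded P_def]]) (fact Sreal rr)+
      then show ?thesis
      proof
        assume "\<exists>\<alpha> \<beta> P Q. lin_fun_on n \<alpha> \<and> lin_fun_on n \<beta> \<and>
          (\<forall>f\<in>Cn n. real_poly f \<longrightarrow> \<alpha> f \<in> \<real>) \<and> (\<forall>f\<in>Cn n. real_poly f \<longrightarrow> \<beta> f \<in> \<real>) \<and>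
          P \<in> H1R \<and> Q \<in> H1R \<and> zeros_interlace P Q \<and>
          (\<forall>f\<in>Cn n. S f = smult (\<alpha> f) P + smult (\<beta> f) Q)"
        then obtain \<alpha> \<beta> P Q where *: "lin_fun_on n \<alpha>" "lin_fun_on n \<beta>"
          "\<forall>f\<in>Cn n. real_poly f \<longrightarrow> \<alpha> f \<in> \<real>" "\<forall>f\<in>Cn n. real_poly f \<longrightarrow> \<beta> f \<in> \<real>"
          "P \<in> H1R" "Q \<in> H1R" "zeros_interlace P Q"
          "\<forall>f\<in>Cn n. S f = smult (\<alpha> f) P + smult (\<beta> f) Q" by blast
        have "\<forall>f\<in>Cn n. T f = smult (\<eta> * \<alpha> f) P + smult (\<eta> * \<beta> f) Q"
          using *(8) by (simp add: TS smult_add_right)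
        then show ?thesis using *(1-7) by blast
      qed (use rank1 in blast)
    next
      case False
      then obtain h where "degree h \<le> n" "real_poly h" "S h \<notin> pi_set \<real> \<union> {0}" by blast
      then have "(\<forall>z w. Im z > 0 \<longrightarrow> Im w > 0 \<longrightarrow> poly (S ([:w, 1:] ^ n)) z \<noteq> 0) \<or>
          (\<forall>z w. Im z > 0 \<longrightarrow> Im w > 0 \<longrightarrow> poly (S ([:- w, 1:] ^ n)) z \<noteq> 0)"
        by (rule symbol_nonvanishing[OF S, rotated]) (fact Spres)
      then show ?thesis
      proof
        assume "\<forall>z w. Im z > 0 \<longrightarrow> Im w > 0 \<longrightarrow> poly (S ([:w, 1:] ^ n)) z \<noteq> 0"
        then have "smult [:inverse \<eta>:] (extT T (symbol_base 1 ^ n)) \<in> H2R"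
          unfolding symbol_H2R_iff[OF T Reals_1 one_neq_zero]
          using 1 by (simp add: S_def)
        then show ?thesis unfolding symbol_base_plus by blast
      next
        assume "\<forall>z w. Im z > 0 \<longrightarrow> Im w > 0 \<longrightarrow> poly (S ([:- w, 1:] ^ n)) z \<noteq> 0"
        moreover have "- 1 \<in> (\<real> :: complex set)" "- 1 \<noteq> (0 :: complex)" by auto
        ultimately have "smult [:inverse \<eta>:] (extT T (symbol_base (- 1) ^ n)) \<in> H2R"
          using 1 by (subst symbol_H2R_iff[OF T]) (simp_all add: S_def)
        then show ?thesis unfolding symbol_base_minus by blast
      qed
    qed
  qed (use rank1 in blast)
qed

theorem mainTheorem2:
  fixes n :: nat and T :: "complex poly \<Rightarrow> complex poly"
  assumes lin: "lin_op_on n T"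
  shows "(\<forall>f \<in> pi_n_set n \<real>. T f \<in> pi_set \<real> \<union> {0}) \<longleftrightarrow>
   ( (range_dim_le 1 n T \<and>
       (\<exists>\<alpha> P. lin_fun_on n \<alpha> \<and> P \<in> H1R \<and> (\<forall>f\<in>Cn n. T f = smult (\<alpha> f) P)))
   \<or> (range_dim_le 2 n T \<and>
       (\<exists>\<eta> \<alpha> \<beta> P Q. lin_fun_on n \<alpha> \<and> lin_fun_on n \<beta> \<and>
          (\<forall>f\<in>Cn n. real_poly f \<longrightarrow> \<alpha> f \<in> \<real>) \<and>
          (\<forall>f\<in>Cn n. real_poly f \<longrightarrow> \<beta> f \<in> \<real>) \<and>
          P \<in> H1R \<and> Q \<in> H1R \<and> zeros_interlace P Q \<and>
          (\<forall>f\<in>Cn n. T f = smult (\<eta> * \<alpha> f) P + smult (\<eta> * \<beta> f) Q)))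
   \<or> (\<exists>\<eta>. smult [:\<eta>:] (extT T (z_plus_w ^ n)) \<in> H2R)
   \<or> (\<exists>\<eta>. smult [:\<eta>:] (extT T (z_minus_w ^ n)) \<in> H2R) )"
    (is "?pres \<longleftrightarrow> (_ \<and> ?a) \<or> (_ \<and> ?b) \<or> ?c \<or> ?d")
proof
  assume ?pres
  then have "?a \<or> ?b \<or> ?c \<or> ?d"
    by (intro preserver_classification[OF lin]) blast
  moreover have "range_dim_le 1 n T" if ?a using that range_dim_le_1 by metis
  moreover have "range_dim_le 2 n T" if ?b
    using that by (elim exE conjE) (rule range_dim_le_2)
  ultimately show "(range_dim_le 1 n T \<and> ?a) \<or> (range_dim_le 2 n T \<and> ?b) \<or> ?c \<or> ?d"
    by satx
next
  assume "(range_dim_le 1 n T \<and> ?a) \<or> (range_dim_le 2 n T \<and> ?b) \<or> ?c \<or> ?d"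
  then consider ?a | ?b | ?c | ?d by satx
  then show ?pres
  proof cases
    case 1
    then obtain \<alpha> P where P: "P \<in> H1R" and eq: "\<forall>f\<in>Cn n. T f = smult (\<alpha> f) P" by blast
    show ?thesis
    proof
      fix f assume "f \<in> pi_n_set n \<real>"
      then have "T f = smult (\<alpha> f) P" using eq by (simp add: Cn_def pi_n_set_def)
      then show "T f \<in> pi_set \<real> \<union> {0}" using P by (auto simp: H1R_def pi_set_def)
    qed
  next
    case 2
    then obtain \<eta> \<alpha> \<beta> P Q where *: "P \<in> H1R" "Q \<in> H1R" "zeros_interlace P Q"
      "lin_fun_on n \<alpha>" "\<forall>f\<in>Cn n. real_poly f \<longrightarrow> \<alpha> f \<in> \<real>"
      "lin_fun_on n \<beta>" "\<forall>f\<in>Cn n. real_poly f \<longrightarrow> \<beta> f \<in> \<real>"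
      and eq: "\<forall>f\<in>Cn n. T f = smult (\<eta> * \<alpha> f) P + smult (\<eta> * \<beta> f) Q" by blast
    show ?thesis
    proof
      fix f assume f: "f \<in> pi_n_set n \<real>"
      then have "T f = smult (\<eta> * \<alpha> f) P + smult (\<eta> * \<beta> f) Q"
        using eq by (simp add: Cn_def pi_n_set_def)
      then show "T f \<in> pi_set \<real> \<union> {0}"
        using interlacing_pair_preserves_real_rooted[OF * f, of \<eta>] by simp
    qed
  next
    case 3
    then show ?thesis using symbol_H2R_preserves_real_rooted_plus[OF lin] by blast
  next
    case 4
    then show ?thesis using symbol_H2R_preserves_real_rooted_minus[OF lin] by blast
  qed
qed

end
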